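(* Let $h(t)=a_0+a_2t^2+\dots+a_{2s}t^{2s}$ be an even univariate real polynomial which is nonnegative on $[-1,1]$ and let $k$ be a positive integer. Define the linear map $\hat{\Gamma}_h:R_{2k}\to R_{2k}$ by \[\hat{\Gamma}_h(f)(x)=\sum_{j=0}^s a_{2j}\,\frac{\int_S\langle x,y\rangle^{2j}f(y)\,d\mu(y)}{\|x\|^{2(j-k)}}.\] Let $(X,W)$ be a cubature rule of algebraic degree $2(s+k)$ for $\mu$, and let $Q\subseteq R_{2k}$ be the set of polynomials in $R_{2k}$ that have nonnegative values at all points of $X$. Then the set $A:=\hat{\Gamma}_h(Q)$ is a polyhedral cone in $R_{2k}$ and the inclusions $A\subseteq P_{2k}\subseteq Q$ hold.
   Context: $S\subseteq\mathbb{R}^n$ is the unit sphere, $\mu$ is the $(n-1)$-dimensional area measure on $S$, and $R_d\subseteq\mathbb{R}[x_1,\dots,x_n]$ is the space of homogeneous polynomials of degree $d$. $P_{2k}\subseteq R_{2k}$ is the cone of forms of degree $2k$ which are nonnegative on $S$. A cubature rule of algebraic degree $2t$ for $\mu$ is a pair $(X,W)$ with $X\subseteq S$ finite and $W:X\to\mathbb{R}_{>0}$ such that $\int_S f\,d\mu=\sum_{x\in X}W(x)f(x)$ for every $f\in R_{2t}$. A polyhedral cone is a convex cone defined by finitely many linear inequalities (equivalently, finitely generated). In the formula for $\hat\Gamma_h$, division by a power $\|x\|^{2(j-k)}$ with $j<k$ means multiplication by $\|x\|^{2(k-j)}$; for $j\ge k$ the quotient is a polynomial, so $\hat\Gamma_h$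 is well defined as a linear endomorphism of $R_{2k}$. *)

theory Defs
  imports "HOL-Analysis.Analysis" "HOL-Computational_Algebra.Polynomial"
begin

text \<open>Surface measure on the unit sphere, as a measure with space \<open>sphere 0 1\<close>: the area of a
  Borel set \<open>A\<close> is \<open>n\<close> times the Lebesgue volume of the punctured cone
  \<open>{r x | x \<in> A, 0 < r < 1}\<close> (integration in polar coordinates; see
  \<open>emeasure_sphere_measure\<close>). Note that \<open>sgn x = x / \<parallel>x\<parallel>\<close>. For \<open>n = 1\<close> this is the counting
  measure on \<open>{-1, 1}\<close>.\<close>

definition sphere_measure :: "(real ^ 'n) measure" where
  "sphere_measure =
     scale_measure (of_nat CARD('n))
       (distr (restrict_space lborel (ball 0 1 - {0})) (restrict_space borel (sphere 0 1)) sgn)"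

text \<open>A form is identified with the function it induces, which is harmless over the reals. The
  index set of the sum is finite because \<open>'n\<close> is.\<close>

definition forms :: "nat \<Rightarrow> (real ^ 'n \<Rightarrow> real) set" where
  "forms d = {f. \<exists>c :: ('n \<Rightarrow> nat) \<Rightarrow> real.
     f = (\<lambda>x. \<Sum>\<alpha> | (\<Sum>i\<in>UNIV. \<alpha> i) = d. c \<alpha> * (\<Prod>i\<in>UNIV. (x $ i) ^ \<alpha> i))}"

definition nonneg_forms :: "nat \<Rightarrow> (real ^ 'n \<Rightarrow> real) set" where
  "nonneg_forms d = {f \<in> forms d. \<forall>x\<in>sphere 0 1. 0 \<le> f x}"

definition cubature_rule :: "nat \<Rightarrow> (real ^ 'n) set \<Rightarrow> (real ^ 'n \<Rightarrow> real) \<Rightarrow> bool" where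
  "cubature_rule d X W \<longleftrightarrow>
     finite X \<and> X \<subseteq> sphere 0 1 \<and> (\<forall>x\<in>X. 0 < W x) \<and>
     (\<forall>f\<in>forms d. (LINT x|sphere_measure. f x) = (\<Sum>x\<in>X. W x * f x))"

text \<open>The \<open>powi\<close> has a possibly negative exponent, so that for \<open>j < k\<close> the division is a
  multiplication by \<open>\<parallel>x\<parallel>\<close> to the power \<open>2 (k - j)\<close>. At \<open>x = 0\<close> every summand evaluates to \<open>0\<close>
  when \<open>k > 0\<close>, which is the value of a form of degree \<open>2 k\<close>. If \<open>h\<close> has degree at most \<open>2 s\<close>,
  summing up to \<open>degree h div 2\<close> is the same as summing up to \<open>s\<close>.\<close>

definition Gamma_hat :: "real poly \<Rightarrow> nat \<Rightarrow> (real ^ 'n \<Rightarrow> real) \<Rightarrow> real ^ 'n \<Rightarrow> real" where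
  "Gamma_hat h k f = (\<lambda>x. \<Sum>j\<le>degree h div 2. coeff h (2 * j) *
     ((LINT y|sphere_measure. (x \<bullet> y) ^ (2 * j) * f y) / norm x powi (2 * (int j - int k))))"

text \<open>Spaces of functions carry no \<open>real_vector\<close> instance, so linearity of a functional on a
  subspace \<open>V\<close> of functions is spelled out pointwise.\<close>

definition linear_functional_on :: "('a \<Rightarrow> real) set \<Rightarrow> (('a \<Rightarrow> real) \<Rightarrow> real) \<Rightarrow> bool" where
  "linear_functional_on V l \<longleftrightarrow>
     (\<forall>f\<in>V. \<forall>g\<in>V. l (\<lambda>x. f x + g x) = l f + l g) \<and>
     (\<forall>f\<in>V. \<forall>c. l (\<lambda>x. c * f x) = c * l f)"

definition polyhedral_cone_in :: "('a \<Rightarrow> real) set \<Rightarrow> ('a \<Rightarrow> real) set \<Rightarrow> bool" where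
  "polyhedral_cone_in V A \<longleftrightarrow>
     (\<exists>L. finite L \<and> (\<forall>l\<in>L. linear_functional_on V l) \<and> A = {f \<in> V. \<forall>l\<in>L. 0 \<le> l f})"

lemma finite_exponents: "finite {\<alpha> :: 'n::finite \<Rightarrow> nat. (\<Sum>i\<in>UNIV. \<alpha> i) = d}"
proof (rule finite_subset)
  show "{\<alpha> :: 'n \<Rightarrow> nat. (\<Sum>i\<in>UNIV. \<alpha> i) = d} \<subseteq> PiE UNIV (\<lambda>_. {..d})"
    by (auto simp: PiE_UNIV_domain member_le_sum)
  show "finite (PiE (UNIV :: 'n set) (\<lambda>_. {..d}))"
    by (rule finite_PiE) auto
qed

lemma space_sphere_measure: "space (sphere_measure :: (real ^ 'n) measure) = sphere 0 1"
  by (simp add: sphere_measure_def space_scale_measure space_restrict_space)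

lemma sets_sphere_measure:
  "sets (sphere_measure :: (real ^ 'n) measure) = sets (restrict_space borel (sphere 0 1))"
  by (simp add: sphere_measure_def)

lemma sgn_measurable_sphere:
  "sgn \<in> measurable (restrict_space lborel (ball 0 1 - {0 :: real ^ 'n}))
           (restrict_space borel (sphere 0 1))"
proof (rule measurable_restrict_space2)
  show "sgn \<in> space (restrict_space lborel (ball 0 1 - {0 :: real ^ 'n})) \<rightarrow> sphere 0 1"
    by (auto simp: space_restrict_space norm_sgn)
  have "(sgn :: real ^ 'n \<Rightarrow> _) \<in> borel_measurable lborel"
    unfolding sgn_div_norm[abs_def] by measurable
  then show "sgn \<in> borel_measurable (restrict_space lborel (ball 0 1 - {0 :: real ^ 'n}))"
    by (rule measurable_restrict_space1)
qed

lemma emeasure_sphere_measure: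
  assumes "A \<in> sets (sphere_measure :: (real ^ 'n) measure)"
  shows "emeasure sphere_measure A =
    of_nat CARD('n) * emeasure lborel {r *\<^sub>R x | r x. 0 < r \<and> r < 1 \<and> x \<in> A}"
proof -
  have A: "A \<in> sets (restrict_space borel (sphere 0 1))" and "A \<subseteq> sphere 0 1"
    using assms sets.sets_into_space[OF assms]
    by (simp_all add: sets_sphere_measure space_sphere_measure)
  have "sgn -` A \<inter> (ball 0 1 - {0}) = {r *\<^sub>R x | r x. 0 < r \<and> r < 1 \<and> x \<in> A}" (is "?L = ?R")
  proof (intro equalityI subsetI)
    fix x assume "x \<in> ?L"
    then have "x = norm x *\<^sub>R sgn x" "0 < norm x" "norm x < 1" "sgn x \<in> A"
      by (auto simp: sgn_div_norm)
    then show "x \<in> ?R" by blast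
  next
    fix y assume "y \<in> ?R"
    then obtain r x where "y = r *\<^sub>R x" "0 < r" "r < 1" "x \<in> A" by blast
    with \<open>A \<subseteq> sphere 0 1\<close> show "y \<in> ?L" by (auto simp: sgn_div_norm subset_iff)
  qed
  moreover from this have "?R \<subseteq> ball 0 1 - {0}" by blast
  ultimately show ?thesis
    by (simp add: sphere_measure_def emeasure_distr[OF sgn_measurable_sphere A]
        space_restrict_space emeasure_restrict_space)
qed

end

theory Submission
  imports Defs
begin

text \<open>On the sphere \<open>\<Gamma>\<^sub>h f(x)\<close> is the integral of \<open>h(x \<bullet> y) f(y)\<close>, and the cubature rule turns it into
  \<open>\<Sum>\<^sub>z W(z) h(x \<bullet> z) f(z)\<close>, which is nonnegative when \<open>f\<close> is nonnegative on \<open>X\<close>. The set \<open>Q\<close> is cut out by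
  finitely many linear inequalities, and by Fourier--Motzkin elimination so is its image under a
  linear map. What remains is that \<open>\<Gamma>\<^sub>h f\<close> is a form, i.e. that the integral of
  \<open>(x \<bullet> y)\<^sup>a f(y)\<close> is divisible by \<open>\<parallel>x\<parallel>\<^sup>a\<^sup>-\<^sup>m\<close> when \<open>f\<close> is a form of degree \<open>m \<le> a\<close> and \<open>a - m\<close> is even.
  This goes by induction on \<open>m\<close>: differentiating the rotation invariance of the integral lowers \<open>m\<close>.
  As all integrands are forms of degree at most \<open>2 (s + k)\<close>, the integral can be replaced by the
  cubature sum throughout, so that only finite sums have to be differentiated.\<close>

section \<open>Forms\<close>

lemma forms_add:
  assumes "f \<in> forms d" "g \<in> forms d"
  shows "(\<lambda>x. f x + g x) \<in> forms d"
proof -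
  obtain a b where "f = (\<lambda>x. \<Sum>\<alpha> | (\<Sum>i\<in>UNIV. \<alpha> i) = d. a \<alpha> * (\<Prod>i\<in>UNIV. (x $ i) ^ \<alpha> i))"
    "g = (\<lambda>x. \<Sum>\<alpha> | (\<Sum>i\<in>UNIV. \<alpha> i) = d. b \<alpha> * (\<Prod>i\<in>UNIV. (x $ i) ^ \<alpha> i))"
    using assms unfolding forms_def by blast
  then show ?thesis
    unfolding forms_def
    by (intro CollectI exI[of _ "\<lambda>\<alpha>. a \<alpha> + b \<alpha>"]) (simp add: sum.distrib distrib_right)
qed

lemma forms_cmult:
  assumes "f \<in> forms d"
  shows "(\<lambda>x. c * f x) \<in> forms d"
proof -
  obtain a where "f = (\<lambda>x. \<Sum>\<alpha> | (\<Sum>i\<in>UNIV. \<alpha> i) = d. a \<alpha> * (\<Prod>i\<in>UNIV. (x $ i) ^ \<alpha> i))"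
    using assms unfolding forms_def by blast
  then show ?thesis
    unfolding forms_def
    by (intro CollectI exI[of _ "\<lambda>\<alpha>. c * a \<alpha>"]) (simp add: sum_distrib_left mult.assoc)
qed

lemma forms_zero: "(\<lambda>x. 0) \<in> forms d"
  unfolding forms_def by (intro CollectI exI[of _ "\<lambda>\<alpha>. 0"]) simp

lemma forms_sum:
  assumes "\<And>i. i \<in> I \<Longrightarrow> f i \<in> forms d"
  shows "(\<lambda>x. \<Sum>i\<in>I. f i x) \<in> forms d"
proof (cases "finite I")
  case True
  then show ?thesis
    using assms by (induction I) (simp_all add: forms_zero forms_add)
qed (simp add: forms_zero)

lemma forms_minus:
  assumes "f \<in> forms d" "g \<in> forms d"
  shows "(\<lambda>x. f x - g x) \<in> forms d"
  using forms_add[OF assms(1) forms_cmult[OF assms(2), of "-1"]] by simp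

lemma monomial_in_forms:
  fixes \<alpha> :: "'n::finite \<Rightarrow> nat"
  assumes "(\<Sum>i\<in>UNIV. \<alpha> i) = d"
  shows "(\<lambda>x :: real ^ 'n. \<Prod>i\<in>UNIV. (x $ i) ^ \<alpha> i) \<in> forms d"
  unfolding forms_def using assms
  by (intro CollectI exI[of _ "\<lambda>\<beta>. if \<beta> = \<alpha> then 1 else 0"])
    (auto simp: finite_exponents if_distrib[of "\<lambda>c. c * _"] cong: if_cong)

lemma sum_fun_upd_Suc:
  fixes \<alpha> :: "'n::finite \<Rightarrow> nat"
  shows "(\<Sum>i\<in>UNIV. (\<alpha>(j := Suc (\<alpha> j))) i) = Suc (\<Sum>i\<in>UNIV. \<alpha> i)"
proof -
  have "(\<Sum>i\<in>UNIV. (\<alpha>(j := Suc (\<alpha> j))) i) = (\<Sum>i\<in>UNIV. \<alpha> i + (if i = j then 1 else 0))"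
    by (intro sum.cong) auto
  then show ?thesis by (simp add: sum.distrib)
qed

lemma prod_fun_upd_Suc:
  fixes \<alpha> :: "'n::finite \<Rightarrow> nat" and x :: "real ^ 'n"
  shows "(\<Prod>i\<in>UNIV. (x $ i) ^ (\<alpha>(j := Suc (\<alpha> j))) i) = x $ j * (\<Prod>i\<in>UNIV. (x $ i) ^ \<alpha> i)"
proof -
  have "(\<Prod>i\<in>UNIV. (x $ i) ^ (\<alpha>(j := Suc (\<alpha> j))) i)
      = (\<Prod>i\<in>UNIV. (if i = j then x $ i else 1) * (x $ i) ^ \<alpha> i)"
    by (intro prod.cong) auto
  then show ?thesis by (simp add: prod.distrib)
qed

lemma forms_coord_mult:
  assumes "f \<in> forms d"
  shows "(\<lambda>x. x $ j * f x) \<in> forms (Suc d)"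
proof -
  obtain a where a: "f = (\<lambda>x. \<Sum>\<alpha> | (\<Sum>i\<in>UNIV. \<alpha> i) = d. a \<alpha> * (\<Prod>i\<in>UNIV. (x $ i) ^ \<alpha> i))"
    using assms unfolding forms_def by blast
  have "(\<lambda>x. x $ j * f x) = (\<lambda>x. \<Sum>\<alpha> | (\<Sum>i\<in>UNIV. \<alpha> i) = d.
      a \<alpha> * (\<Prod>i\<in>UNIV. (x $ i) ^ (\<alpha>(j := Suc (\<alpha> j))) i))"
    unfolding a prod_fun_upd_Suc by (simp add: sum_distrib_left mult.left_commute)
  also have "\<dots> \<in> forms (Suc d)"
    by (intro forms_sum forms_cmult monomial_in_forms) (simp add: sum_fun_upd_Suc del: fun_upd_apply)
  finally show ?thesis .
qed

text \<open>Every monomial of positive degree contains some variable. One is chosen for each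
  exponent and stripped off, and the monomials are grouped by the chosen variable.\<close>

lemma forms_SucE:
  fixes f :: "real ^ 'n::finite \<Rightarrow> real"
  assumes "f \<in> forms (Suc d)"
  obtains g where "\<And>i. g i \<in> forms d" "f = (\<lambda>x. \<Sum>i\<in>UNIV. x $ i * g i x)"
proof -
  let ?A = "{\<alpha> :: 'n \<Rightarrow> nat. (\<Sum>i\<in>UNIV. \<alpha> i) = Suc d}"
  obtain a where a: "f = (\<lambda>x. \<Sum>\<alpha>\<in>?A. a \<alpha> * (\<Prod>i\<in>UNIV. (x $ i) ^ \<alpha> i))"
    using assms unfolding forms_def by blast
  have "\<exists>j \<beta>. \<alpha> = \<beta>(j := Suc (\<beta> j))" if "\<alpha> \<in> ?A" for \<alpha>
  proof -
    from that obtain j where "\<alpha> j \<noteq> 0"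
      by (metis (mono_tags) mem_Collect_eq nat.distinct(1) sum.neutral)
    then have "\<alpha> = (\<alpha>(j := \<alpha> j - 1))(j := Suc ((\<alpha>(j := \<alpha> j - 1)) j))" by auto
    then show ?thesis by blast
  qed
  then obtain j \<beta> where \<beta>: "\<And>\<alpha>. \<alpha> \<in> ?A \<Longrightarrow> \<alpha> = (\<beta> \<alpha>)(j \<alpha> := Suc (\<beta> \<alpha> (j \<alpha>)))"
    by metis
  define g where "g i = (\<lambda>x :: real ^ 'n. \<Sum>\<alpha>\<in>{\<alpha> \<in> ?A. j \<alpha> = i}. a \<alpha> * (\<Prod>l\<in>UNIV. (x $ l) ^ \<beta> \<alpha> l))" for i
  have deg: "(\<Sum>i\<in>UNIV. \<beta> \<alpha> i) = d" if "\<alpha> \<in> ?A" for \<alpha>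
    using sum_fun_upd_Suc[of "\<beta> \<alpha>" "j \<alpha>"] \<beta>[OF that] that by simp
  have "f x = (\<Sum>i\<in>UNIV. x $ i * g i x)" for x
  proof -
    have "f x = (\<Sum>\<alpha>\<in>?A. a \<alpha> * (x $ j \<alpha> * (\<Prod>l\<in>UNIV. (x $ l) ^ \<beta> \<alpha> l)))"
      unfolding a prod_fun_upd_Suc[symmetric] using \<beta> by (intro sum.cong refl) metis
    also have "\<dots> = (\<Sum>i\<in>UNIV. \<Sum>\<alpha>\<in>{\<alpha> \<in> ?A. j \<alpha> = i}. a \<alpha> * (x $ j \<alpha> * (\<Prod>l\<in>UNIV. (x $ l) ^ \<beta> \<alpha> l)))"
      by (rule sum.group[symmetric]) (auto simp: finite_exponents)
    also have "\<dots> = (\<Sum>i\<in>UNIV. x $ i * g i x)"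
      unfolding g_def sum_distrib_left by (intro sum.cong) auto
    finally show ?thesis .
  qed
  moreover have "g i \<in> forms d" for i
    unfolding g_def by (intro forms_sum forms_cmult monomial_in_forms) (use deg in auto)
  ultimately show ?thesis using that by blast
qed

lemma forms_0: "forms 0 = {f :: real ^ 'n::finite \<Rightarrow> real. \<exists>c. f = (\<lambda>x. c)}"
proof -
  have "{\<alpha> :: 'n \<Rightarrow> nat. (\<Sum>i\<in>UNIV. \<alpha> i) = 0} = {\<lambda>i. 0}" by auto
  then have "forms 0 = {f. \<exists>c :: ('n \<Rightarrow> nat) \<Rightarrow> real. f = (\<lambda>x :: real ^ 'n. c (\<lambda>i. 0))}"
    unfolding forms_def by simp
  then show ?thesis by (auto intro: exI[of _ "\<lambda>_. _"])
qed

lemma const_in_forms_0: "(\<lambda>x. c) \<in> forms 0"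
  by (auto simp: forms_0)

text \<open>By \<open>forms_SucE\<close>, constants, sums and multiplication by a coordinate
  generate all forms, so properties of forms can be proved without handling coefficient
  families.\<close>

lemma forms_induct [consumes 1, case_names const add coord_mult]:
  fixes f :: "real ^ 'n::finite \<Rightarrow> real"
  assumes "f \<in> forms d"
    and const: "\<And>c. P 0 (\<lambda>x. c)"
    and add: "\<And>d f g. f \<in> forms d \<Longrightarrow> P d f \<Longrightarrow> g \<in> forms d \<Longrightarrow> P d g \<Longrightarrow> P d (\<lambda>x. f x + g x)"
    and coord_mult: "\<And>d i f. f \<in> forms d \<Longrightarrow> P d f \<Longrightarrow> P (Suc d) (\<lambda>x. x $ i * f x)"
  shows "P d f"
  using assms(1)
proof (induction d arbitrary: f)
  case 0
  then show ?case using const by (auto simp: forms_0)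
next
  case (Suc d)
  obtain g where g: "\<And>i. g i \<in> forms d" and f: "f = (\<lambda>x. \<Sum>i\<in>UNIV. x $ i * g i x)"
    using forms_SucE[OF Suc.prems] by blast
  \<comment> \<open>The induction starts at singletons, since the empty sum, the zero form of
    positive degree, has no case of its own.\<close>
  have "P (Suc d) (\<lambda>x. \<Sum>i\<in>I. x $ i * g i x)" if "finite I" "I \<noteq> {}" for I
    using that
  proof (induction I rule: finite_ne_induct)
    case (singleton i)
    then show ?case using coord_mult[OF g Suc.IH[OF g]] by simp
  next
    case (insert i I)
    then show ?case
      using add[OF forms_coord_mult[OF g] coord_mult[OF g Suc.IH[OF g]]
          forms_sum[OF forms_coord_mult[OF g]] insert.IH] by simp
  qed
  then show ?case unfolding f by simp
qed

section \<open>Products, powers and linear substitutions of forms\<close>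

lemma forms_mult:
  assumes "f \<in> forms d" "g \<in> forms e"
  shows "(\<lambda>x. f x * g x) \<in> forms (d + e)"
  using assms(1)
proof (induction rule: forms_induct)
  case (const c)
  then show ?case using forms_cmult[OF assms(2)] by simp
next
  case (add d f h)
  then show ?case using forms_add by (simp add: distrib_right)
next
  case (coord_mult d i f)
  then show ?case using forms_coord_mult by (simp add: mult.assoc)
qed

lemma forms_power:
  assumes "f \<in> forms d"
  shows "(\<lambda>x. f x ^ n) \<in> forms (d * n)"
  by (induction n) (auto simp: const_in_forms_0 intro: forms_mult[OF assms])

lemma inner_in_forms: "(\<lambda>x. a \<bullet> x) \<in> forms 1"
proof -
  have "(\<lambda>x. a $ i * (x $ i * 1)) \<in> forms (Suc 0)" for i
    by (intro forms_cmult forms_coord_mult const_in_forms_0)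
  then have "(\<lambda>x. \<Sum>i\<in>UNIV. a $ i * (x $ i * 1)) \<in> forms 1"
    by (intro forms_sum) simp
  then show ?thesis by (simp add: inner_vec_def)
qed

lemma inner_power_in_forms: "(\<lambda>x. (a \<bullet> x) ^ n) \<in> forms n"
  using forms_power[OF inner_in_forms, of a n] by simp

text \<open>Evenness makes this a power of the polynomial \<open>x \<bullet> x\<close>. Multiplying
  by it raises the degree of a form without changing its values on the sphere.\<close>

lemma norm_power_in_forms:
  assumes "even n"
  shows "(\<lambda>x :: real ^ 'n::finite. norm x ^ n) \<in> forms n"
proof -
  have "(\<lambda>x :: real ^ 'n. x $ i * (x $ i * 1)) \<in> forms (Suc (Suc 0))" for i
    by (intro forms_coord_mult const_in_forms_0)
  then have "(\<lambda>x :: real ^ 'n. \<Sum>i\<in>UNIV. x $ i * (x $ i * 1)) \<in> forms 2"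
    unfolding numeral_2_eq_2 by (intro forms_sum) simp
  then have "(\<lambda>x :: real ^ 'n. x \<bullet> x) \<in> forms 2"
    by (simp add: inner_vec_def)
  from forms_power[OF this, of "n div 2"] assms show ?thesis
    by (auto simp: dot_square_norm elim!: evenE) (simp add: power_mult)
qed

lemma forms_compose_linear:
  assumes "f \<in> forms d" "linear T"
  shows "(\<lambda>x. f (T x)) \<in> forms d"
  using assms(1)
proof (induction rule: forms_induct)
  case (const c)
  then show ?case by (rule const_in_forms_0)
next
  case (add d f h)
  then show ?case using forms_add by blast
next
  case (coord_mult d i f)
  \<comment> \<open>A coordinate of \<open>T x\<close> is the inner product of \<open>x\<close> with
    the image of an axis vector under the adjoint.\<close>
  have "(\<lambda>x. T x $ i) \<in> forms 1"
    using inner_in_forms[of "adjoint T (axis i 1)"]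
    by (simp add: adjoint_clauses[OF assms(2)] inner_axis' )
  from forms_mult[OF this coord_mult.IH] show ?case by simp
qed

section \<open>Derivatives and continuity of forms\<close>

text \<open>The \<open>f' i\<close> are the partial derivatives. Natural subtraction gives
  \<open>d - 1 = 0\<close> for \<open>d = 0\<close>, so their vanishing in that case is recorded
  separately; it lets \<open>x $ j * f' i x\<close> count as a form of degree \<open>d\<close> there
  too.\<close>

lemma forms_has_derivative:
  fixes f :: "real ^ 'n::finite \<Rightarrow> real"
  assumes "f \<in> forms d"
  shows "\<exists>f'. (\<forall>i. f' i \<in> forms (d - 1)) \<and> (d = 0 \<longrightarrow> (\<forall>i x. f' i x = 0)) \<and>
    (\<forall>x. (f has_derivative (\<lambda>v. \<Sum>i\<in>UNIV. v $ i * f' i x)) (at x))"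
  using assms
proof (induction rule: forms_induct)
  case (const c)
  then show ?case by (intro exI[of _ "\<lambda>_ _. 0"]) (simp add: forms_zero)
next
  case (add d f g)
  then obtain f' g' where "\<forall>i. f' i \<in> forms (d - 1)" "\<forall>i. g' i \<in> forms (d - 1)"
    "d = 0 \<longrightarrow> (\<forall>i x. f' i x = 0)" "d = 0 \<longrightarrow> (\<forall>i x. g' i x = 0)"
    "\<And>x. (f has_derivative (\<lambda>v. \<Sum>i\<in>UNIV. v $ i * f' i x)) (at x)"
    "\<And>x. (g has_derivative (\<lambda>v. \<Sum>i\<in>UNIV. v $ i * g' i x)) (at x)"
    by blast
  then show ?case
    by (intro exI[of _ "\<lambda>i x. f' i x + g' i x"])
      (auto simp: forms_add distrib_left sum.distrib intro: has_derivative_add)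
next
  case (coord_mult d j f)
  then obtain f' where f': "\<And>i. f' i \<in> forms (d - 1)" "d = 0 \<Longrightarrow> (\<forall>i x. f' i x = 0)"
    and D: "\<And>x. (f has_derivative (\<lambda>v. \<Sum>i\<in>UNIV. v $ i * f' i x)) (at x)"
    by blast
  let ?g = "\<lambda>i x. (if i = j then 1 else 0) * f x + x $ j * f' i x"
  have "(\<lambda>x. x $ j * f' i x) \<in> forms d" for i
  proof (cases "d = 0")
    case False
    then show ?thesis using forms_coord_mult[OF f'(1)[of i], of j] by simp
  qed (simp add: f' forms_zero)
  then have "?g i \<in> forms d" for i
    by (intro forms_add forms_cmult coord_mult.hyps)
  moreover have "((\<lambda>x. x $ j * f x) has_derivative (\<lambda>v. \<Sum>i\<in>UNIV. v $ i * ?g i x)) (at x)" for x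
  proof -
    have "((\<lambda>x. x $ j * f x) has_derivative
        (\<lambda>v. x $ j * (\<Sum>i\<in>UNIV. v $ i * f' i x) + v $ j * f x)) (at x)"
      by (rule has_derivative_mult[OF bounded_linear_imp_has_derivative[OF bounded_linear_vec_nth] D])
    moreover have "x $ j * (\<Sum>i\<in>UNIV. v $ i * f' i x) + v $ j * f x = (\<Sum>i\<in>UNIV. v $ i * ?g i x)" for v
    proof -
      have "(\<Sum>i\<in>UNIV. v $ i * ?g i x)
          = (\<Sum>i\<in>UNIV. (if i = j then v $ i * f x else 0) + x $ j * (v $ i * f' i x))"
        by (intro sum.cong) (auto simp: algebra_simps)
      then show ?thesis by (simp add: sum.distrib sum_distrib_left)
    qed
    ultimately show ?thesis by simp
  qed
  ultimately show ?case by (intro exI[of _ ?g]) auto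
qed

lemma continuous_on_form:
  assumes "f \<in> forms d"
  shows "continuous_on S f"
  using forms_has_derivative[OF assms] has_derivative_continuous
  by (intro continuous_at_imp_continuous_on ballI) blast

lemma form_at_0:
  assumes "f \<in> forms d" "d > 0"
  shows "f 0 = 0"
  using assms by (induction rule: forms_induct) auto

section \<open>Rotation invariance of the surface measure\<close>

text \<open>The Vitali covering theorem fills \<open>U\<close> up to a null set with disjoint balls.
  An orthogonal map sends each to a ball of the same radius, hence of the same volume, and the
  images stay disjoint inside the image of \<open>U\<close>.\<close>

lemma emeasure_open_le_orthogonal_image:
  fixes T :: "'a::euclidean_space \<Rightarrow> 'a"
  assumes T: "orthogonal_transformation T" and U: "open U"
  shows "emeasure lborel U \<le> emeasure lborel (T ` U)"
proof -
  \<comment> \<open>Centres and radii of the balls inside \<open>U\<close>. Around each point of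
    \<open>U\<close> they can be taken arbitrarily small, as the covering theorem demands.\<close>
  define K where "K = {(c, r). 0 < r \<and> ball c r \<subseteq> U}"
  have "\<exists>i. i \<in> K \<and> x \<in> ball (fst i) (snd i) \<and> snd i < d" if "x \<in> U" "0 < d" for x :: 'a and d
  proof -
    obtain e where "e > 0" "ball x e \<subseteq> U" using U \<open>x \<in> U\<close> openE by blast
    then show ?thesis using \<open>0 < d\<close>
      by (intro exI[of _ "(x, min e (d / 2))"]) (auto simp: K_def)
  qed
  from Vitali_covering_theorem_balls[of U K fst snd, OF this] obtain C where
    C: "countable C" "C \<subseteq> K" "pairwise (\<lambda>i j. disjnt (ball (fst i) (snd i)) (ball (fst j) (snd j))) C"
    and null: "negligible (U - (\<Union>i\<in>C. ball (fst i) (snd i)))"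
    by blast
  let ?V = "\<Union>i\<in>C. ball (fst i) (snd i)"
  have inj: "inj T"
    using T by (rule orthogonal_transformation_inj)
  have ball: "T ` ball c r = ball (T c) r" for c r
    using image_orthogonal_transformation_ball[OF T] .
  have disj: "disjoint_family_on (\<lambda>i. ball (fst i) (snd i)) C"
    using C(3) by (auto simp: pairwise_def disjoint_family_on_def disjnt_def)
  then have disj': "disjoint_family_on (\<lambda>i. T ` ball (fst i) (snd i)) C"
    using inj by (simp add: disjoint_family_on_def image_Int[symmetric])
  have sub: "?V \<subseteq> U" using C(2) unfolding K_def by fastforce
  have "emeasure lborel U = emeasure lborel (?V \<union> (U - ?V))"
    using sub by (simp add: Un_absorb1)
  also have "\<dots> = emeasure lborel ?V"
  proof (rule emeasure_Un_null_set)
    have "open ?V" by blast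
    then show "?V \<in> sets lborel" by simp
    then show "U - ?V \<in> null_sets lborel"
      using null U by (simp add: negligible_iff_null_sets null_sets_completion_iff)
  qed
  also have "\<dots> = (\<integral>\<^sup>+i. emeasure lborel (ball (fst i) (snd i)) \<partial>count_space C)"
    by (rule emeasure_UN_countable[OF _ C(1) disj]) auto
  also have "\<dots> = (\<integral>\<^sup>+i. emeasure lborel (T ` ball (fst i) (snd i)) \<partial>count_space C)"
    using C(2) by (intro nn_integral_cong) (force simp: ball K_def emeasure_ball)
  also have "\<dots> = emeasure lborel (\<Union>i\<in>C. T ` ball (fst i) (snd i))"
    by (rule emeasure_UN_countable[OF _ C(1) disj', symmetric]) (auto simp: ball)
  also have "\<dots> \<le> emeasure lborel (T ` U)"
  proof (rule emeasure_mono)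
    have "open (T ` U)"
      using U T inj by (simp add: open_surjective_linear_image orthogonal_transformation_linear orthogonal_transformation_surj)
    then show "T ` U \<in> sets lborel" by simp
  qed (use sub in blast)
  finally show ?thesis .
qed

lemma borel_measurable_orthogonal:
  fixes T :: "'a::euclidean_space \<Rightarrow> 'a"
  assumes "orthogonal_transformation T"
  shows "T \<in> borel_measurable borel"
  using assms
  by (intro borel_measurable_continuous_onI linear_continuous_on)
    (simp add: linear_conv_bounded_linear[symmetric] orthogonal_transformation_linear)

text \<open>The inequality for open sets, applied to \<open>T\<close> and to its inverse, gives
  equality on boxes, and boxes determine \<open>lborel\<close>.\<close>

lemma lborel_distr_orthogonal:
  fixes T :: "'a::euclidean_space \<Rightarrow> 'a"
  assumes T: "orthogonal_transformation T"
  shows "distr lborel borel T = lborel"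
proof (rule lborel_eqI[symmetric])
  have meas: "T \<in> borel_measurable lborel"
    using borel_measurable_orthogonal[OF T] by simp
  fix l u :: 'a
  assume le: "\<And>b. b \<in> Basis \<Longrightarrow> l \<bullet> b \<le> u \<bullet> b"
  have bij: "bij T" using T by (rule orthogonal_transformation_bij)
  have T': "orthogonal_transformation (inv T)" using T by (rule orthogonal_transformation_inv)
  have vim: "T -` box l u = inv T ` box l u"
    using bij by (simp add: bij_vimage_eq_inv_image)
  have "open (T -` box l u)"
    using T by (intro open_vimage linear_continuous_on)
      (auto simp: linear_conv_bounded_linear[symmetric] orthogonal_transformation_linear)
  from emeasure_open_le_orthogonal_image[OF T this]
  have "emeasure lborel (T -` box l u) \<le> emeasure lborel (box l u)"
    using bij by (simp add: surj_image_vimage_eq bij_is_surj)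
  moreover have "emeasure lborel (box l u) \<le> emeasure lborel (T -` box l u)"
    using emeasure_open_le_orthogonal_image[OF T' open_box] by (simp add: vim)
  ultimately show "emeasure (distr lborel borel T) (box l u) = (\<Prod>b\<in>Basis. (u - l) \<bullet> b)"
    using le by (simp add: emeasure_distr[OF meas] emeasure_lborel_box antisym)
qed simp

text \<open>Area is the volume of a cone up to a constant factor, and \<open>T\<close> commutes with
  scaling, so the cone over the preimage of \<open>A\<close> is the preimage of the cone over
  \<open>A\<close>. Invariance of Lebesgue measure then applies.\<close>

lemma sphere_measure_distr_orthogonal:
  fixes T :: "real ^ 'n \<Rightarrow> real ^ 'n"
  assumes T: "orthogonal_transformation T"
  shows "T \<in> measurable sphere_measure sphere_measure"
    and "distr sphere_measure sphere_measure T = sphere_measure"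
proof -
  have norm: "norm (T x) = norm x" for x
    using T by (simp add: orthogonal_transformation_norm)
  have T_borel: "T \<in> borel_measurable borel"
    using borel_measurable_orthogonal[OF T] by simp
  have "T \<in> measurable (restrict_space borel (sphere 0 1)) (restrict_space borel (sphere 0 1))"
    by (rule measurable_restrict_space2)
      (auto simp: space_restrict_space norm intro: measurable_restrict_space1 T_borel)
  then show meas: "T \<in> measurable sphere_measure sphere_measure"
    by (simp add: measurable_cong_sets[OF sets_sphere_measure sets_sphere_measure])
  show "distr sphere_measure sphere_measure T = sphere_measure"
  proof (rule measure_eqI)
    fix A assume "A \<in> sets (distr sphere_measure sphere_measure T)"
    then have A: "A \<in> sets (sphere_measure :: (real ^ 'n) measure)" by simp
    then have A_sub: "A \<subseteq> sphere 0 1"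
      using sets.sets_into_space space_sphere_measure by blast
    let ?cone = "\<lambda>A. {r *\<^sub>R x | r x. 0 < r \<and> r < 1 \<and> x \<in> A}"
    have TA: "T -` A \<inter> space sphere_measure \<in> sets sphere_measure"
      using meas A by (rule measurable_sets)
    have scale: "T (r *\<^sub>R x) = r *\<^sub>R T x" for r x
      using T by (rule orthogonal_transformation_scaleR)
    have "?cone (T -` A \<inter> sphere 0 1) = T -` ?cone A"
    proof (intro equalityI subsetI)
      fix y assume "y \<in> T -` ?cone A"
      then obtain r x where rx: "0 < r" "r < 1" "x \<in> A" "T y = r *\<^sub>R x" by blast
      then have "T (inverse r *\<^sub>R y) = x" by (simp add: scale)
      moreover have "y = r *\<^sub>R (inverse r *\<^sub>R y)" using rx by simp
      moreover have "norm (inverse r *\<^sub>R y) = 1"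
        using calculation(1) rx A_sub norm by (metis mem_sphere_0 subsetD)
      ultimately show "y \<in> ?cone (T -` A \<inter> sphere 0 1)"
        using rx by (intro CollectI exI[of _ r] exI[of _ "inverse r *\<^sub>R y"]) auto
    qed (auto simp: scale, blast)
    \<comment> \<open>The cone is Borel because it is the preimage of \<open>A\<close> under
      \<open>sgn\<close> in the punctured ball.\<close>
    moreover have "?cone A \<in> sets borel"
    proof -
      have "sgn -` A \<inter> (ball 0 1 - {0}) \<in> sets (restrict_space lborel (ball 0 1 - {0 :: real ^ 'n}))"
        using measurable_sets[OF sgn_measurable_sphere, of A] A
        by (simp add: sets_sphere_measure space_restrict_space)
      then have "sgn -` A \<inter> (ball 0 1 - {0}) \<in> sets borel"
        by (subst (asm) sets_restrict_space_iff) auto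
      moreover have "sgn -` A \<inter> (ball 0 1 - {0}) = ?cone A"
      proof (intro equalityI subsetI)
        fix x assume "x \<in> sgn -` A \<inter> (ball 0 1 - {0})"
        then have "x = norm x *\<^sub>R sgn x" "0 < norm x" "norm x < 1" "sgn x \<in> A"
          by (auto simp: sgn_div_norm)
        then show "x \<in> ?cone A" by blast
      next
        fix y assume "y \<in> ?cone A"
        then obtain r x where "y = r *\<^sub>R x" "0 < r" "r < 1" "x \<in> A" by blast
        with A_sub show "y \<in> sgn -` A \<inter> (ball 0 1 - {0})"
          by (auto simp: sgn_div_norm subset_iff)
      qed
      ultimately show ?thesis by simp
    qed
    moreover from this have "emeasure lborel (T -` ?cone A) = emeasure lborel (?cone A)"
      using emeasure_distr[of T lborel borel "?cone A"] T_borel lborel_distr_orthogonal[OF T] by simp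
    ultimately show "emeasure (distr sphere_measure sphere_measure T) A = emeasure sphere_measure A"
      using TA by (simp add: emeasure_distr[OF meas A] emeasure_sphere_measure[OF A]
          emeasure_sphere_measure space_sphere_measure)
  qed simp
qed

lemma sphere_integral_orthogonal:
  fixes T :: "real ^ 'n \<Rightarrow> real ^ 'n" and f :: "real ^ 'n \<Rightarrow> real"
  assumes T: "orthogonal_transformation T" and f: "continuous_on (sphere 0 1) f"
  shows "(LINT x|sphere_measure. f (T x)) = (LINT x|sphere_measure. f x)"
proof -
  have "f \<in> borel_measurable (restrict_space borel (sphere 0 1))"
    using f by (rule borel_measurable_continuous_on_restrict)
  then have "f \<in> borel_measurable sphere_measure"
    by (simp add: measurable_cong_sets[OF sets_sphere_measure refl])
  from integral_distr[OF sphere_measure_distr_orthogonal(1)[OF T] this] show ?thesis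
    by (simp add: sphere_measure_distr_orthogonal(2)[OF T])
qed

section \<open>Linear images of polyhedral cones\<close>

text \<open>Each added function enlarges the space of combinations vanishing on \<open>P\<close> by
  at most one dimension, and one further point removes it. This serves to turn an equality of
  functions into finitely many equations.\<close>

lemma finite_determining_points:
  fixes b :: "'b \<Rightarrow> 'a \<Rightarrow> real"
  assumes "finite B"
  shows "\<exists>P. finite P \<and> (\<forall>c. (\<forall>p\<in>P. (\<Sum>\<beta>\<in>B. c \<beta> * b \<beta> p) = 0) \<longrightarrow> (\<forall>x. (\<Sum>\<beta>\<in>B. c \<beta> * b \<beta> x) = 0))"
  using assms
proof (induction B)
  case empty
  then show ?case by auto
next
  case (insert \<beta> B)
  let ?S = "\<lambda>c x. \<Sum>\<beta>\<in>insert \<beta> B. c \<beta> * b \<beta> x"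
  obtain P where P: "finite P"
    "\<And>c x. \<forall>p\<in>P. (\<Sum>\<beta>\<in>B. c \<beta> * b \<beta> p) = 0 \<Longrightarrow> (\<Sum>\<beta>\<in>B. c \<beta> * b \<beta> x) = 0"
    using insert.IH by blast
  have P0: "?S c x = 0" if "c \<beta> = 0" "\<forall>p\<in>P. ?S c p = 0" for c x
    using that insert.hyps P(2)[of c x] by simp
  have lin: "?S (\<lambda>\<alpha>. d \<alpha> - t * c \<alpha>) x = ?S d x - t * ?S c x" for d t c x
    by (simp only: sum_distrib_left sum_subtractf[symmetric]) (intro sum.cong, auto simp: algebra_simps)
  show ?case
  proof (cases "\<exists>c x. (\<forall>p\<in>P. ?S c p = 0) \<and> ?S c x \<noteq> 0")
    case True
    then obtain c x0 where c: "\<forall>p\<in>P. ?S c p = 0" "?S c x0 \<noteq> 0" by blast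
    then have "c \<beta> \<noteq> 0" using P0 by blast
    have "?S d x = 0" if d: "\<forall>p\<in>insert x0 P. ?S d p = 0" for d x
    proof -
      \<comment> \<open>Subtracting this multiple of \<open>c\<close> removes the coefficient at
        \<open>\<beta>\<close>, so the remainder vanishes everywhere by \<open>P0\<close>. Hence
        \<open>?S d\<close> is a multiple of \<open>?S c\<close>, and the point \<open>x0\<close>
        forces the factor to be zero.\<close>
      let ?e = "\<lambda>\<alpha>. d \<alpha> - d \<beta> / c \<beta> * c \<alpha>"
      have "?S ?e y = 0" for y
        by (rule P0) (use d c(1) \<open>c \<beta> \<noteq> 0\<close> in \<open>auto simp only: lin\<close>, simp_all)
      then have *: "?S d y = d \<beta> / c \<beta> * ?S c y" for y
        unfolding lin by simp
      from *[of x0] d c(2) have "d \<beta> / c \<beta> = 0" by auto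
      with *[of x] show ?thesis by simp
    qed
    then show ?thesis using \<open>finite P\<close> by (intro exI[of _ "insert x0 P"]) blast
  qed (use \<open>finite P\<close> in blast)
qed

section \<open>Elimination of variables from linear inequalities\<close>

text \<open>A constraint with \<open>d k > 0\<close> bounds \<open>t\<close> from below by
  \<open>- a k / d k\<close>, one with \<open>d k < 0\<close> bounds it from above. Besides the
  constraints free of \<open>t\<close>, what matters is that no lower bound exceeds an upper one,
  stated here with denominators cleared.\<close>

lemma one_variable_elimination:
  fixes a d :: "'k \<Rightarrow> real"
  assumes K: "finite K"
  shows "(\<exists>t. \<forall>k\<in>K. 0 \<le> a k + d k * t) \<longleftrightarrow>
    (\<forall>k\<in>K. d k = 0 \<longrightarrow> 0 \<le> a k) \<and>
    (\<forall>p\<in>K. \<forall>q\<in>K. 0 < d p \<longrightarrow> d q < 0 \<longrightarrow> 0 \<le> - d q * a p + d p * a q)"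
    (is "?L \<longleftrightarrow> ?Z \<and> ?R")
proof (intro iffI conjI)
  assume ?L
  then obtain t where t: "\<And>k. k \<in> K \<Longrightarrow> 0 \<le> a k + d k * t" by blast
  then show ?Z by force
  show ?R
  proof (intro ballI impI)
    fix p q assume "p \<in> K" "q \<in> K" "0 < d p" "d q < 0"
    then have "0 \<le> - d q * (a p + d p * t)" "0 \<le> d p * (a q + d q * t)"
      using t[of p] t[of q] by (intro mult_nonneg_nonneg; simp)+
    then show "0 \<le> - d q * a p + d p * a q" by (simp add: algebra_simps)
  qed
next
  assume R: "?Z \<and> ?R"
  let ?P = "{k \<in> K. 0 < d k}" and ?N = "{k \<in> K. d k < 0}"
  let ?r = "\<lambda>k. - a k / d k"
  have le: "?r p \<le> ?r q" if "p \<in> ?P" "q \<in> ?N" for p q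
    using R that by (force simp: field_simps)
  \<comment> \<open>The largest lower bound serves as \<open>t\<close>; if there is none, the
    smallest upper bound does.\<close>
  have "\<exists>t. (\<forall>p\<in>?P. ?r p \<le> t) \<and> (\<forall>q\<in>?N. t \<le> ?r q)"
  proof (cases "?P = {}")
    case True
    have "\<exists>t. \<forall>q\<in>?N. t \<le> ?r q"
      by (cases "?N = {}") (use K in \<open>auto intro!: exI[of _ "Min (?r ` ?N)"]\<close>)
    with True show ?thesis by blast
  next
    case False
    then show ?thesis
      using K le by (intro exI[of _ "Max (?r ` ?P)"] conjI ballI) (auto simp: Max_le_iff)
  qed
  then obtain t where t: "\<And>p. p \<in> ?P \<Longrightarrow> ?r p \<le> t" "\<And>q. q \<in> ?N \<Longrightarrow> t \<le> ?r q" by blast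
  have "0 \<le> a k + d k * t" if "k \<in> K" for k
  proof -
    consider "d k = 0" | "0 < d k" | "d k < 0" by linarith
    then show ?thesis
    proof cases
      case 1
      then show ?thesis using R that by simp
    next
      case 2
      then show ?thesis using t(1)[of k] that by (simp add: field_simps)
    next
      case 3
      then show ?thesis using t(2)[of k] that by (simp add: field_simps)
    qed
  qed
  then show ?L by blast
qed

lemma linear_functional_on_lincomb:
  assumes "linear_functional_on V l" "linear_functional_on V l'"
  shows "linear_functional_on V (\<lambda>g. s * l g + t * l' g)"
  using assms unfolding linear_functional_on_def by (simp add: algebra_simps)

text \<open>Fourier--Motzkin elimination of the variables \<open>c b\<close>.\<close>

lemma polyhedral_cone_in_projection:
  fixes V :: "('a \<Rightarrow> real) set" and K :: "((('a \<Rightarrow> real) \<Rightarrow> real) \<times> ('b \<Rightarrow> real)) set"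
  assumes "finite B" "finite K" "\<And>l d. (l, d) \<in> K \<Longrightarrow> linear_functional_on V l"
  shows "polyhedral_cone_in V {g \<in> V. \<exists>c. \<forall>(l, d)\<in>K. 0 \<le> l g + (\<Sum>b\<in>B. d b * c b)}"
  using assms
proof (induction B arbitrary: K)
  case empty
  then show ?case
    unfolding polyhedral_cone_in_def by (intro exI[of _ "fst ` K"]) auto
next
  case (insert \<beta> B)
  \<comment> \<open>For \<open>p\<close> in \<open>?P\<close> and \<open>q\<close> in
    \<open>?N\<close> both multipliers are positive, and the combination cancels the coefficient of
    the variable \<open>c \<beta>\<close>.\<close>
  let ?comb = "\<lambda>(p :: (('a \<Rightarrow> real) \<Rightarrow> real) \<times> ('b \<Rightarrow> real)) q. (\<lambda>g. (- snd q \<beta>) * fst p g + snd p \<beta> * fst q g,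
    \<lambda>b. - snd q \<beta> * snd p b + snd p \<beta> * snd q b)"
  let ?P = "{k \<in> K. 0 < snd k \<beta>}" and ?N = "{k \<in> K. snd k \<beta> < 0}"
  define K' where "K' = {k \<in> K. snd k \<beta> = 0} \<union> (\<lambda>(p, q). ?comb p q) ` (?P \<times> ?N)"
  let ?val = "\<lambda>B c g (k :: (('a \<Rightarrow> real) \<Rightarrow> real) \<times> ('b \<Rightarrow> real)). fst k g + (\<Sum>b\<in>B. snd k b * c b)"
  have val_comb: "?val B c g (?comb p q) = - snd q \<beta> * ?val B c g p + snd p \<beta> * ?val B c g q" for c g p q
  proof -
    have "(\<Sum>b\<in>B. (- snd q \<beta> * snd p b + snd p \<beta> * snd q b) * c b)
        = - snd q \<beta> * (\<Sum>b\<in>B. snd p b * c b) + snd p \<beta> * (\<Sum>b\<in>B. snd q b * c b)"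
      by (simp add: algebra_simps sum.distrib sum_subtractf sum_negf sum_distrib_left)
    then show ?thesis by (simp add: algebra_simps)
  qed
  have K': "(\<forall>k\<in>K'. 0 \<le> ?val B c g k) \<longleftrightarrow> (\<exists>t. \<forall>k\<in>K. 0 \<le> ?val B c g k + snd k \<beta> * t)" for c g
    unfolding one_variable_elimination[OF insert.prems(1)] K'_def ball_Un ball_simps
    by (auto simp only: val_comb split_paired_Ball_Sigma mem_Collect_eq ball_simps prod.case)
  have "(\<exists>c. \<forall>k\<in>K. 0 \<le> ?val (insert \<beta> B) c g k) \<longleftrightarrow> (\<exists>c. \<forall>k\<in>K'. 0 \<le> ?val B c g k)" for g
  proof
    assume "\<exists>c. \<forall>k\<in>K. 0 \<le> ?val (insert \<beta> B) c g k"
    then obtain c where "\<forall>k\<in>K. 0 \<le> ?val (insert \<beta> B) c g k" by blast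
    then have "\<forall>k\<in>K. 0 \<le> ?val B c g k + snd k \<beta> * c \<beta>"
      using insert.hyps by (simp add: add_ac)
    then show "\<exists>c. \<forall>k\<in>K'. 0 \<le> ?val B c g k" unfolding K' by blast
  next
    assume "\<exists>c. \<forall>k\<in>K'. 0 \<le> ?val B c g k"
    then obtain c t where ct: "\<forall>k\<in>K. 0 \<le> ?val B c g k + snd k \<beta> * t"
      unfolding K' by blast
    \<comment> \<open>Storing the recovered value \<open>t\<close> at \<open>\<beta>\<close> does
      not disturb the sum over \<open>B\<close>, as \<open>\<beta>\<close> lies outside
      \<open>B\<close>.\<close>
    have "(\<Sum>b\<in>B. d b * (c(\<beta> := t)) b) = (\<Sum>b\<in>B. d b * c b)" for d
      using insert.hyps by (intro sum.cong) auto
    with ct have "\<forall>k\<in>K. 0 \<le> ?val (insert \<beta> B) (c(\<beta> := t)) g k"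
      using insert.hyps by (simp add: add_ac)
    then show "\<exists>c. \<forall>k\<in>K. 0 \<le> ?val (insert \<beta> B) c g k" by blast
  qed
  moreover have "polyhedral_cone_in V {g \<in> V. \<exists>c. \<forall>(l, d)\<in>K'. 0 \<le> l g + (\<Sum>b\<in>B. d b * c b)}"
  proof (rule insert.IH)
    show "finite K'" unfolding K'_def using insert.prems(1) by auto
    have "linear_functional_on V (fst k)" if "k \<in> K" for k
      using that insert.prems(2) by (cases k) auto
    then have "linear_functional_on V (fst k)" if "k \<in> K'" for k
      using that linear_functional_on_lincomb[of V "fst _" "fst _" "- snd _ \<beta>" "snd _ \<beta>"]
      unfolding K'_def by fastforce
    then show "linear_functional_on V l" if "(l, d) \<in> K'" for l d
      using that by fastforce
  qed
  ultimately show ?case by (simp add: case_prod_beta)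
qed

text \<open>Membership of \<open>g\<close> in the image is the existence of coefficients
  \<open>c\<close> that satisfy finitely many inequalities linear in \<open>g\<close> and
  \<open>c\<close> jointly. Eliminating \<open>c\<close> leaves conditions on \<open>g\<close>
  alone.\<close>

lemma polyhedral_cone_in_linear_image:
  fixes V :: "('a \<Rightarrow> real) set" and b \<gamma> :: "'b \<Rightarrow> 'a \<Rightarrow> real"
  assumes B: "finite B" and V: "V = {f. \<exists>c. f = (\<lambda>x. \<Sum>\<beta>\<in>B. c \<beta> * b \<beta> x)}"
    and \<gamma>: "\<And>\<beta>. \<beta> \<in> B \<Longrightarrow> \<gamma> \<beta> \<in> V" and X: "finite X"
    and \<Gamma>: "\<And>c. \<Gamma> (\<lambda>x. \<Sum>\<beta>\<in>B. c \<beta> * b \<beta> x) = (\<lambda>x. \<Sum>\<beta>\<in>B. c \<beta> * \<gamma> \<beta> x)"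
  shows "polyhedral_cone_in V (\<Gamma> ` {f \<in> V. \<forall>z\<in>X. 0 \<le> f z})"
proof -
  obtain P where P: "finite P"
    and P0: "\<And>c x. \<forall>p\<in>P. (\<Sum>\<beta>\<in>B. c \<beta> * b \<beta> p) = 0 \<Longrightarrow> (\<Sum>\<beta>\<in>B. c \<beta> * b \<beta> x) = 0"
    using finite_determining_points[OF B, of b] by blast
  have "\<forall>\<beta>\<in>B. \<exists>m. \<gamma> \<beta> = (\<lambda>x. \<Sum>\<alpha>\<in>B. m \<alpha> * b \<alpha> x)" using \<gamma> V by auto
  then obtain m where m: "\<And>\<beta>. \<beta> \<in> B \<Longrightarrow> \<gamma> \<beta> = (\<lambda>x. \<Sum>\<alpha>\<in>B. m \<beta> \<alpha> * b \<alpha> x)" by metis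
  have image: "(\<lambda>x. \<Sum>\<beta>\<in>B. c \<beta> * \<gamma> \<beta> x) = (\<lambda>x. \<Sum>\<alpha>\<in>B. (\<Sum>\<beta>\<in>B. c \<beta> * m \<beta> \<alpha>) * b \<alpha> x)" for c
  proof
    fix x
    have "(\<Sum>\<beta>\<in>B. c \<beta> * \<gamma> \<beta> x) = (\<Sum>\<beta>\<in>B. \<Sum>\<alpha>\<in>B. c \<beta> * (m \<beta> \<alpha> * b \<alpha> x))"
      by (simp add: m sum_distrib_left)
    also have "\<dots> = (\<Sum>\<alpha>\<in>B. \<Sum>\<beta>\<in>B. c \<beta> * (m \<beta> \<alpha> * b \<alpha> x))" by (rule sum.swap)
    finally show "(\<Sum>\<beta>\<in>B. c \<beta> * \<gamma> \<beta> x) = (\<Sum>\<alpha>\<in>B. (\<Sum>\<beta>\<in>B. c \<beta> * m \<beta> \<alpha>) * b \<alpha> x)"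
      by (simp add: sum_distrib_right mult.assoc)
  qed
  \<comment> \<open>The difference of the two sides lies in the span of the
    \<open>b \<beta>\<close>, with coefficients \<open>?d\<close>, so it vanishes once it vanishes
    on \<open>P\<close>.\<close>
  have eq_iff: "g = (\<lambda>x. \<Sum>\<beta>\<in>B. c \<beta> * \<gamma> \<beta> x) \<longleftrightarrow> (\<forall>p\<in>P. g p = (\<Sum>\<beta>\<in>B. c \<beta> * \<gamma> \<beta> p))"
    if g: "g \<in> V" for g c
  proof
    assume *: "\<forall>p\<in>P. g p = (\<Sum>\<beta>\<in>B. c \<beta> * \<gamma> \<beta> p)"
    obtain e where e: "g = (\<lambda>x. \<Sum>\<beta>\<in>B. e \<beta> * b \<beta> x)" using g V by blast
    let ?d = "\<lambda>\<alpha>. e \<alpha> - (\<Sum>\<beta>\<in>B. c \<beta> * m \<beta> \<alpha>)"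
    have d: "(\<Sum>\<alpha>\<in>B. ?d \<alpha> * b \<alpha> x) = g x - (\<Sum>\<beta>\<in>B. c \<beta> * \<gamma> \<beta> x)" for x
      using fun_cong[OF image, of c x] by (simp add: e left_diff_distrib sum_subtractf)
    show "g = (\<lambda>x. \<Sum>\<beta>\<in>B. c \<beta> * \<gamma> \<beta> x)"
      using P0[of ?d] * unfolding d by (auto simp: fun_eq_iff)
  qed simp
  \<comment> \<open>The first two families express equality at each point of \<open>P\<close> as two
    opposite inequalities. The third is nonnegativity on \<open>X\<close>, in which \<open>g\<close>
    does not occur.\<close>
  define K :: "((('a \<Rightarrow> real) \<Rightarrow> real) \<times> ('b \<Rightarrow> real)) set" where
    "K = (\<lambda>p. (\<lambda>g. g p, \<lambda>\<beta>. - \<gamma> \<beta> p)) ` P \<union> (\<lambda>p. (\<lambda>g. - g p, \<lambda>\<beta>. \<gamma> \<beta> p)) ` P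
      \<union> (\<lambda>z. (\<lambda>g. 0, \<lambda>\<beta>. b \<beta> z)) ` X"
  have "\<Gamma> ` {f \<in> V. \<forall>z\<in>X. 0 \<le> f z}
      = {g \<in> V. \<exists>c. g = (\<lambda>x. \<Sum>\<beta>\<in>B. c \<beta> * \<gamma> \<beta> x) \<and> (\<forall>z\<in>X. 0 \<le> (\<Sum>\<beta>\<in>B. c \<beta> * b \<beta> z))}"
    (is "?I = ?J")
  proof (intro equalityI subsetI)
    fix g assume "g \<in> ?I"
    then show "g \<in> ?J" unfolding V by (force simp: \<Gamma> image)
  next
    fix g assume "g \<in> ?J"
    then show "g \<in> ?I" unfolding V by (force simp: \<Gamma>)
  qed
  also have "\<dots> = {g \<in> V. \<exists>c. \<forall>(l, d)\<in>K. 0 \<le> l g + (\<Sum>\<beta>\<in>B. d \<beta> * c \<beta>)}"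
  proof (intro Collect_cong conj_cong refl ex_cong1)
    fix g c assume "g \<in> V"
    show "(g = (\<lambda>x. \<Sum>\<beta>\<in>B. c \<beta> * \<gamma> \<beta> x) \<and> (\<forall>z\<in>X. 0 \<le> (\<Sum>\<beta>\<in>B. c \<beta> * b \<beta> z)))
      \<longleftrightarrow> (\<forall>(l, d)\<in>K. 0 \<le> l g + (\<Sum>\<beta>\<in>B. d \<beta> * c \<beta>))"
      unfolding eq_iff[OF \<open>g \<in> V\<close>] K_def
      by (auto simp: ball_Un sum_negf mult.commute order_antisym_conv)
  qed
  also have "polyhedral_cone_in V \<dots>"
    by (rule polyhedral_cone_in_projection[OF B])
      (use P X in \<open>auto simp: K_def linear_functional_on_def\<close>)
  finally show ?thesis .
qed

section \<open>Cubature sums of forms\<close>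

text \<open>The factor \<open>norm x ^ (2 * (N - M))\<close> lifts the form to degree
  \<open>2 * N\<close> and equals \<open>1\<close> on the sphere, which carries both the measure and
  \<open>X\<close>.\<close>

lemma cubature_rule_integral:
  fixes X :: "(real ^ 'n) set"
  assumes cub: "cubature_rule (2 * N) X W" and f: "f \<in> forms (2 * M)" and "M \<le> N"
  shows "(LINT x|sphere_measure. f x) = (\<Sum>z\<in>X. W z * f z)"
proof -
  have "(\<lambda>x. f x * norm x ^ (2 * (N - M))) \<in> forms (2 * M + 2 * (N - M))"
    by (intro forms_mult f norm_power_in_forms) simp
  then have "(\<lambda>x. f x * norm x ^ (2 * (N - M))) \<in> forms (2 * N)"
    using \<open>M \<le> N\<close> by (simp flip: distrib_left)
  then have "(LINT x|sphere_measure. f x * norm x ^ (2 * (N - M)))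
      = (\<Sum>z\<in>X. W z * (f z * norm z ^ (2 * (N - M))))"
    using cub by (auto simp: cubature_rule_def)
  moreover have "(LINT x|sphere_measure. f x * norm x ^ (2 * (N - M))) = (LINT x|sphere_measure. f x)"
    by (intro Bochner_Integration.integral_cong) (auto simp: space_sphere_measure)
  moreover have "(\<Sum>z\<in>X. W z * (f z * norm z ^ (2 * (N - M)))) = (\<Sum>z\<in>X. W z * f z)"
    using cub by (intro sum.cong) (auto simp: cubature_rule_def subset_iff)
  ultimately show ?thesis by simp
qed

section \<open>Rotation invariance of cubature sums\<close>

text \<open>The set \<open>X\<close> need not be invariant under \<open>T\<close>, but both sums
  equal integrals of forms of the same degree, and the integral is invariant.\<close>

lemma cubature_rule_orthogonal:
  fixes X :: "(real ^ 'n) set"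
  assumes cub: "cubature_rule (2 * N) X W" and f: "f \<in> forms (2 * M)" and MN: "M \<le> N"
    and T: "orthogonal_transformation T"
  shows "(\<Sum>z\<in>X. W z * f (T z)) = (\<Sum>z\<in>X. W z * f z)"
  using sphere_integral_orthogonal[OF T continuous_on_form[OF f]]
    cubature_rule_integral[OF cub f MN]
    cubature_rule_integral[OF cub forms_compose_linear[OF f orthogonal_transformation_linear[OF T]] MN]
  by simp

text \<open>This is the rotation by the angle \<open>t\<close> in the plane of the coordinates
  \<open>i\<close> and \<open>j\<close>, written as the identity plus a correction so that it is
  easily differentiated at \<open>t = 0\<close>.\<close>

lemma orthogonal_plane_rotation:
  fixes i j :: "'n::finite"
  assumes "i \<noteq> j"
  shows "orthogonal_transformation (\<lambda>y :: real ^ 'n. y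
    + ((cos t - 1) * y $ i - sin t * y $ j) *\<^sub>R axis i 1
    + (sin t * y $ i + (cos t - 1) * y $ j) *\<^sub>R axis j 1)" (is "orthogonal_transformation ?R")
  unfolding orthogonal_transformation
proof (intro conjI allI)
  show "linear ?R"
    by (rule linearI) (simp_all add: algebra_simps)
  fix y :: "real ^ 'n"
  have axis0: "axis i 1 $ j = (0 :: real)" "axis j 1 $ i = (0 :: real)"
    using assms by (simp_all add: axis_def)
  have trig: "(cos t - 1)\<^sup>2 + (sin t)\<^sup>2 = 2 - 2 * cos t"
    using sin_cos_squared_add[of t] by (simp add: power2_eq_square algebra_simps)
  have "(y + p *\<^sub>R axis i 1 + q *\<^sub>R axis j 1) \<bullet> (y + p *\<^sub>R axis i 1 + q *\<^sub>R axis j 1)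
      = y \<bullet> y + 2 * p * y $ i + 2 * q * y $ j + p\<^sup>2 + q\<^sup>2" for p q
    using axis0
    by (simp add: inner_add_left inner_add_right inner_axis inner_axis' power2_eq_square algebra_simps)
  note inner = this
  \<comment> \<open>The mixed terms in \<open>p * q\<close> cancel, and the remaining factor of
    \<open>p\<^sup>2 + q\<^sup>2\<close> becomes zero by \<open>trig\<close>.\<close>
  have ring: "y \<bullet> y + 2 * ((c - 1) * p - d * q) * p + 2 * (d * p + (c - 1) * q) * q
      + ((c - 1) * p - d * q)\<^sup>2 + (d * p + (c - 1) * q)\<^sup>2
      = y \<bullet> y + (2 * (c - 1) + ((c - 1)\<^sup>2 + d\<^sup>2)) * (p\<^sup>2 + q\<^sup>2)" for c d p q :: real
    by (simp add: power2_eq_square algebra_simps)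
  have "?R y \<bullet> ?R y = y \<bullet> y + (2 * (cos t - 1) + ((cos t - 1)\<^sup>2 + (sin t)\<^sup>2)) * ((y $ i)\<^sup>2 + (y $ j)\<^sup>2)"
    unfolding inner by (rule ring)
  also have "\<dots> = y \<bullet> y" unfolding trig by simp
  finally show "norm (?R y) = norm y" by (simp add: norm_eq_sqrt_inner)
qed

text \<open>Invariance under the infinitesimal rotation in the plane spanned by \<open>x\<close> and the
  \<open>i\<close>-th axis.\<close>

lemma cubature_rule_rotation:
  fixes X :: "(real ^ 'n) set"
  assumes cub: "cubature_rule (2 * N) X W" and F: "F \<in> forms (2 * M)" and MN: "M \<le> N"
    and D: "\<And>y. (F has_derivative F' y) (at y)"
  shows "(\<Sum>z\<in>X. W z * F' z (z $ i *\<^sub>R x - (x \<bullet> z) *\<^sub>R axis i 1)) = 0"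
proof -
  \<comment> \<open>The velocity at \<open>t = 0\<close> of the rotation in the plane of the
    coordinates \<open>i\<close> and \<open>j\<close>.\<close>
  let ?v = "\<lambda>j y :: real ^ 'n. y $ i *\<^sub>R axis j 1 - y $ j *\<^sub>R axis i 1 :: real ^ 'n"
  have lin: "linear (F' y)" for y
    by (rule has_derivative_linear[OF D])
  have plane: "(\<Sum>z\<in>X. W z * F' z (?v j z)) = 0" for j
  proof (cases "i = j")
    case True
    then show ?thesis by (simp add: linear_0[OF lin])
  next
    case False
    define R where "R t y = y
      + ((cos t - 1) * y $ i - sin t * y $ j) *\<^sub>R axis i 1
      + (sin t * y $ i + (cos t - 1) * y $ j) *\<^sub>R axis j 1" for t and y :: "real ^ 'n"
    have "((\<lambda>t. R t y) has_derivative (\<lambda>s. s *\<^sub>R ?v j y)) (at 0)" for y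
      unfolding R_def by (auto intro!: derivative_eq_intros simp: algebra_simps)
    moreover have "(F has_derivative F' y) (at (R 0 y))" for y
      using D[of y] by (simp add: R_def)
    ultimately have "((\<lambda>t. F (R t y)) has_derivative (\<lambda>s. F' y (s *\<^sub>R ?v j y))) (at 0)" for y
      by (rule has_derivative_compose)
    then have "((\<lambda>t. \<Sum>z\<in>X. W z * F (R t z)) has_derivative
        (\<lambda>s. \<Sum>z\<in>X. W z * F' z (s *\<^sub>R ?v j z))) (at 0)"
      by (intro has_derivative_sum has_derivative_mult_right)
    \<comment> \<open>The rotated sum is constant in \<open>t\<close>, so its derivative at
      \<open>0\<close> must vanish.\<close>
    moreover have "(\<Sum>z\<in>X. W z * F (R t z)) = (\<Sum>z\<in>X. W z * F z)" for t
      unfolding R_def by (rule cubature_rule_orthogonal[OF cub F MN orthogonal_plane_rotation[OF False]])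
    ultimately have "((\<lambda>t. \<Sum>z\<in>X. W z * F z) has_derivative
        (\<lambda>s. \<Sum>z\<in>X. W z * F' z (s *\<^sub>R ?v j z))) (at (0 :: real))"
      by simp
    then have "(\<lambda>s. \<Sum>z\<in>X. W z * F' z (s *\<^sub>R ?v j z)) = (\<lambda>s. 0)"
      by (rule has_derivative_unique) (rule has_derivative_const)
    from fun_cong[OF this, of 1] show ?thesis by simp
  qed
  \<comment> \<open>The rotation field for \<open>x\<close> is the combination of the coordinate
    fields with weights \<open>x $ j\<close>, so linearity of the derivative reduces the claim to
    \<open>plane\<close>.\<close>
  have expand: "z $ i *\<^sub>R x - (x \<bullet> z) *\<^sub>R axis i 1 = (\<Sum>j\<in>UNIV. x $ j *\<^sub>R ?v j z)" for z
  proof -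
    have "(\<Sum>j\<in>UNIV. x $ j *\<^sub>R ?v j z)
        = z $ i *\<^sub>R (\<Sum>j\<in>UNIV. x $ j *\<^sub>R axis j 1) - (\<Sum>j\<in>UNIV. x $ j * z $ j) *\<^sub>R axis i 1"
      by (simp add: scaleR_diff_right sum_subtractf scaleR_sum_right scaleR_sum_left mult.commute)
    also have "(\<Sum>j\<in>UNIV. x $ j *\<^sub>R axis j 1) = x"
      using basis_expansion[of x] by (simp add: scalar_mult_eq_scaleR)
    finally show ?thesis by (simp add: inner_vec_def)
  qed
  have "(\<Sum>z\<in>X. W z * F' z (z $ i *\<^sub>R x - (x \<bullet> z) *\<^sub>R axis i 1))
      = (\<Sum>z\<in>X. \<Sum>j\<in>UNIV. x $ j * (W z * F' z (?v j z)))"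
    unfolding expand by (simp add: linear_sum[OF lin] linear_scale[OF lin] sum_distrib_left mult.left_commute)
  also have "\<dots> = (\<Sum>j\<in>UNIV. x $ j * (\<Sum>z\<in>X. W z * F' z (?v j z)))"
    unfolding sum_distrib_left by (rule sum.swap)
  finally show ?thesis by (simp add: plane)
qed

section \<open>Moments of cubature sums\<close>

text \<open>As a function of \<open>x\<close> the sum is rotation invariant and homogeneous of
  degree \<open>a\<close>. A rotation taking \<open>u\<close> to the direction of \<open>x\<close>
  identifies the constant.\<close>

lemma cubature_inner_power:
  fixes X :: "(real ^ 'n) set"
  assumes cub: "cubature_rule (2 * N) X W" and a: "even a" "a \<le> 2 * N"
    and "norm u = 1"
  shows "(\<Sum>z\<in>X. W z * (x \<bullet> z) ^ a) = norm x ^ a * (\<Sum>z\<in>X. W z * (u \<bullet> z) ^ a)"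
proof (cases "x = 0")
  case True
  then show ?thesis using assms(4) by (simp add: power_0_left)
next
  case False
  then have "norm u = norm (sgn x)" using \<open>norm u = 1\<close> by (simp add: norm_sgn)
  then obtain T where T: "orthogonal_transformation T" "T u = sgn x"
    using orthogonal_transformation_exists by blast
  have x: "x = norm x *\<^sub>R T u" using False T by (simp add: sgn_div_norm)
  have "(\<lambda>y. (T u \<bullet> y) ^ a) \<in> forms (2 * (a div 2))"
    using inner_power_in_forms[of "T u" a] a by simp
  from cubature_rule_orthogonal[OF cub this _ T(1)] a
  have "(\<Sum>z\<in>X. W z * (T u \<bullet> T z) ^ a) = (\<Sum>z\<in>X. W z * (T u \<bullet> z) ^ a)" by simp
  then have "(\<Sum>z\<in>X. W z * (T u \<bullet> z) ^ a) = (\<Sum>z\<in>X. W z * (u \<bullet> z) ^ a)"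
    using T(1) by (simp add: orthogonal_transformation_def)
  moreover have "(\<Sum>z\<in>X. W z * (x \<bullet> z) ^ a) = norm x ^ a * (\<Sum>z\<in>X. W z * (T u \<bullet> z) ^ a)"
    by (subst x) (simp add: power_mult_distrib sum_distrib_left mult.left_commute)
  ultimately show ?thesis by simp
qed

text \<open>The shape is that of the pointwise derivative in the rotation identity for moments,
  whose terms thereby become separate cubature sums.\<close>

lemma weighted_sum_lincomb:
  fixes P :: "'a \<Rightarrow> real" and C :: "'b \<Rightarrow> 'a \<Rightarrow> real"
  assumes "\<And>z. P z = r * (s * A z - t * B z) + (\<Sum>j\<in>J. x j * C j z) - E z"
  shows "(\<Sum>z\<in>X. w z * P z) = r * (s * (\<Sum>z\<in>X. w z * A z) - t * (\<Sum>z\<in>X. w z * B z))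
    + (\<Sum>j\<in>J. x j * (\<Sum>z\<in>X. w z * C j z)) - (\<Sum>z\<in>X. w z * E z)"
proof -
  have "w z * (\<Sum>j\<in>J. x j * C j z) = (\<Sum>j\<in>J. x j * (w z * C j z))" for z
    by (simp add: sum_distrib_left mult.left_commute)
  then have "w z * P z = r * (s * (w z * A z)) - r * (t * (w z * B z))
      + (\<Sum>j\<in>J. x j * (w z * C j z)) - w z * E z" for z
    by (simp add: assms algebra_simps)
  then have "(\<Sum>z\<in>X. w z * P z) = r * (s * (\<Sum>z\<in>X. w z * A z)) - r * (t * (\<Sum>z\<in>X. w z * B z))
      + (\<Sum>z\<in>X. \<Sum>j\<in>J. x j * (w z * C j z)) - (\<Sum>z\<in>X. w z * E z)"
    by (simp add: sum.distrib sum_subtractf sum_distrib_left)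
  also have "(\<Sum>z\<in>X. \<Sum>j\<in>J. x j * (w z * C j z)) = (\<Sum>j\<in>J. x j * (\<Sum>z\<in>X. w z * C j z))"
    unfolding sum_distrib_left by (rule sum.swap)
  finally show ?thesis by (simp add: right_diff_distrib)
qed

text \<open>The rotation identity for \<open>(x \<bullet> y)\<^sup>a\<^sup>+\<^sup>1 G(y)\<close> lowers the degree of the form \<open>y\<^sub>i G(y)\<close> that is
  integrated against \<open>(x \<bullet> y)\<^sup>a\<close>, at the cost of raising \<open>a\<close> and of a factor \<open>\<parallel>x\<parallel>\<^sup>2\<close>.\<close>

lemma cubature_moment_divisible:
  fixes X :: "(real ^ 'n) set"
  assumes cub: "cubature_rule (2 * N) X W"
    and "f \<in> forms m" "even (a + m)" "m \<le> a" "a + m \<le> 2 * N"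
  shows "\<exists>g\<in>forms m. \<forall>x. x \<noteq> 0 \<longrightarrow>
    (\<Sum>z\<in>X. W z * ((x \<bullet> z) ^ a * f z)) = norm x ^ (a - m) * g x"
  using assms(2-)
proof (induction m arbitrary: a f rule: less_induct)
  case (less m)
  show ?case
  proof (cases m)
    case 0
    then obtain c where c: "f = (\<lambda>x. c)" using less.prems by (auto simp: forms_0)
    obtain u :: "real ^ 'n" where u: "norm u = 1"
      using vector_choose_size zero_le_one by blast
    have "(\<Sum>z\<in>X. W z * ((x \<bullet> z) ^ a * c)) = norm x ^ a * (c * (\<Sum>z\<in>X. W z * (u \<bullet> z) ^ a))" for x
      using arg_cong[OF cubature_inner_power[OF cub _ _ u, of a x], of "\<lambda>v. c * v"] less.prems 0
      by (simp add: sum_distrib_left mult_ac)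
    then show ?thesis unfolding c using 0 const_in_forms_0 by force
  next
    case (Suc d)
    \<comment> \<open>By \<open>forms_SucE\<close> it suffices to treat a single product of a
      coordinate and a form of degree \<open>d\<close>.\<close>
    have step: "\<exists>g\<in>forms m. \<forall>x. x \<noteq> 0 \<longrightarrow>
      (\<Sum>z\<in>X. W z * ((x \<bullet> z) ^ a * (z $ i * G z))) = norm x ^ (a - m) * g x"
      if G: "G \<in> forms d" for i G
    proof -
      obtain G' where G': "\<And>j. G' j \<in> forms (d - 1)" "d = 0 \<Longrightarrow> \<forall>j x. G' j x = 0"
        and D: "\<And>y. (G has_derivative (\<lambda>v. \<Sum>j\<in>UNIV. v $ j * G' j y)) (at y)"
        using forms_has_derivative[OF G] by blast
      \<comment> \<open>Passing from \<open>(a, m)\<close> to \<open>(a + 1, d)\<close> keeps the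
        total degree, hence parity and the bound \<open>2 * N\<close>, while the power of the norm
        grows by two.\<close>
      have e1: "a + 1 - d = a - m + 2" using less.prems Suc by simp
      have IH: "\<exists>g\<in>forms d. \<forall>x. x \<noteq> 0 \<longrightarrow>
          (\<Sum>z\<in>X. W z * ((x \<bullet> z) ^ (a + 1) * F z)) = norm x ^ (a - m + 2) * g x"
        if "F \<in> forms d" for F
        unfolding e1[symmetric] by (rule less.IH[OF _ that]) (use less.prems Suc in auto)
      obtain g1 where g1: "g1 \<in> forms d"
        "\<And>x. x \<noteq> 0 \<Longrightarrow> (\<Sum>z\<in>X. W z * ((x \<bullet> z) ^ (a + 1) * G z)) = norm x ^ (a - m + 2) * g1 x"
        using IH[OF G] by blast
      have "(\<lambda>y. y $ i * G' j y) \<in> forms d" for j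
      proof (cases "d = 0")
        case False
        then show ?thesis using forms_coord_mult[OF G'(1)[of j], of i] by simp
      qed (simp add: G' forms_zero)
      from IH[OF this] have "\<forall>j. \<exists>g. g \<in> forms d \<and> (\<forall>x. x \<noteq> 0 \<longrightarrow>
          (\<Sum>z\<in>X. W z * ((x \<bullet> z) ^ (a + 1) * (z $ i * G' j z))) = norm x ^ (a - m + 2) * g x)"
        by blast
      then obtain g2 where g2: "\<And>j. g2 j \<in> forms d"
        "\<And>j x. x \<noteq> 0 \<Longrightarrow>
          (\<Sum>z\<in>X. W z * ((x \<bullet> z) ^ (a + 1) * (z $ i * G' j z))) = norm x ^ (a - m + 2) * g2 j x"
        unfolding choice_iff by blast
      \<comment> \<open>For positive \<open>d\<close> the form \<open>G' i\<close> has degree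
        \<open>d - 1\<close>, and the induction hypothesis yields two more powers of the norm than
        wanted. They are absorbed into the form, which brings its degree up to
        \<open>m\<close>.\<close>
      have "\<exists>g\<in>forms m. \<forall>x. x \<noteq> 0 \<longrightarrow>
          (\<Sum>z\<in>X. W z * ((x \<bullet> z) ^ (a + 2) * G' i z)) = norm x ^ (a - m + 2) * g x"
      proof (cases d)
        case 0
        then show ?thesis using G'(2) by (intro bexI[of _ "\<lambda>x. 0"]) (auto simp: forms_zero)
      next
        case (Suc e)
        have e2: "a + 2 - e = a - m + 2 + 2" using less.prems Suc \<open>m = Suc d\<close> by simp
        have "G' i \<in> forms e" using G'(1)[of i] Suc by simp
        then have "\<exists>g\<in>forms e. \<forall>x. x \<noteq> 0 \<longrightarrow>
            (\<Sum>z\<in>X. W z * ((x \<bullet> z) ^ (a + 2) * G' i z)) = norm x ^ (a + 2 - e) * g x"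
          by (rule less.IH[rotated]) (use less.prems Suc \<open>m = Suc d\<close> in auto)
        then obtain g where g: "g \<in> forms e" "\<And>x. x \<noteq> 0 \<Longrightarrow>
            (\<Sum>z\<in>X. W z * ((x \<bullet> z) ^ (a + 2) * G' i z)) = norm x ^ (a - m + 2 + 2) * g x"
          unfolding e2 by blast
        have "(\<lambda>x. norm x ^ 2 * g x) \<in> forms (2 + e)"
          by (intro forms_mult norm_power_in_forms g(1)) simp
        then have "(\<lambda>x. norm x ^ 2 * g x) \<in> forms m"
          using Suc \<open>m = Suc d\<close> by simp
        then show ?thesis
        proof (rule bexI[rotated], intro allI impI)
          fix x :: "real ^ 'n" assume "x \<noteq> 0"
          then show "(\<Sum>z\<in>X. W z * ((x \<bullet> z) ^ (a + 2) * G' i z))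
              = norm x ^ (a - m + 2) * ((norm x)\<^sup>2 * g x)"
            unfolding g(2)[OF \<open>x \<noteq> 0\<close>] by (simp only: power_add mult.assoc)
        qed
      qed
      then obtain g3 where g3: "g3 \<in> forms m"
        "\<And>x. x \<noteq> 0 \<Longrightarrow> (\<Sum>z\<in>X. W z * ((x \<bullet> z) ^ (a + 2) * G' i z)) = norm x ^ (a - m + 2) * g3 x"
        by blast
      let ?L = "\<lambda>x. \<Sum>z\<in>X. W z * ((x \<bullet> z) ^ a * (z $ i * G z))"
      \<comment> \<open>This is the infinitesimal rotation applied to
        \<open>(x \<bullet> y) ^ (a + 1) * G y\<close>. Differentiating the inner product produces
        the factor \<open>(norm x)\<^sup>2\<close> on the wanted sum \<open>?L x\<close>.\<close>
      have identity: "(a + 1) * ((norm x)\<^sup>2 * ?L x - x $ i * (\<Sum>z\<in>X. W z * ((x \<bullet> z) ^ (a + 1) * G z)))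
          + (\<Sum>j\<in>UNIV. x $ j * (\<Sum>z\<in>X. W z * ((x \<bullet> z) ^ (a + 1) * (z $ i * G' j z))))
          - (\<Sum>z\<in>X. W z * ((x \<bullet> z) ^ (a + 2) * G' i z)) = 0" (is "?lhs = 0") for x
      proof -
        let ?F' = "\<lambda>y v. (x \<bullet> y) ^ (a + 1) * (\<Sum>j\<in>UNIV. v $ j * G' j y) + (a + 1) * (x \<bullet> v) * (x \<bullet> y) ^ a * G y"
        have F: "(\<lambda>y. (x \<bullet> y) ^ (a + 1) * G y) \<in> forms (2 * ((a + m) div 2))"
          using forms_mult[OF inner_power_in_forms[of x "a + 1"] G] less.prems Suc by simp
        have "((\<lambda>y. (x \<bullet> y) ^ (a + 1) * G y) has_derivative ?F' y) (at y)" for y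
        proof -
          have "((\<lambda>y. (x \<bullet> y) ^ (a + 1)) has_derivative (\<lambda>v. (a + 1) * (x \<bullet> v) * (x \<bullet> y) ^ a)) (at y)"
            using has_derivative_power[OF bounded_linear_imp_has_derivative[OF bounded_linear_inner_right], where n = "a + 1"]
            by simp
          from has_derivative_mult[OF this D] show ?thesis .
        qed
        from cubature_rule_rotation[OF cub F _ this, of i x] less.prems
        have rot: "(\<Sum>z\<in>X. W z * ?F' z (z $ i *\<^sub>R x - (x \<bullet> z) *\<^sub>R axis i 1)) = 0" by simp
        have "?F' z (z $ i *\<^sub>R x - (x \<bullet> z) *\<^sub>R axis i 1)
            = (a + 1) * ((norm x)\<^sup>2 * ((x \<bullet> z) ^ a * (z $ i * G z)) - x $ i * ((x \<bullet> z) ^ (a + 1) * G z))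
              + (\<Sum>j\<in>UNIV. x $ j * ((x \<bullet> z) ^ (a + 1) * (z $ i * G' j z))) - (x \<bullet> z) ^ (a + 2) * G' i z" for z
        proof -
          have "(\<Sum>j\<in>UNIV. (z $ i *\<^sub>R x - (x \<bullet> z) *\<^sub>R axis i 1) $ j * G' j z)
              = (\<Sum>j\<in>UNIV. z $ i * (x $ j * G' j z) - (if j = i then (x \<bullet> z) * G' j z else 0))"
            by (intro sum.cong) (auto simp: axis_def algebra_simps)
          also have "\<dots> = z $ i * (\<Sum>j\<in>UNIV. x $ j * G' j z) - (x \<bullet> z) * G' i z"
            by (simp add: sum_subtractf sum_distrib_left)
          finally have 1: "(\<Sum>j\<in>UNIV. (z $ i *\<^sub>R x - (x \<bullet> z) *\<^sub>R axis i 1) $ j * G' j z)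
              = z $ i * (\<Sum>j\<in>UNIV. x $ j * G' j z) - (x \<bullet> z) * G' i z" .
          have 2: "x \<bullet> (z $ i *\<^sub>R x - (x \<bullet> z) *\<^sub>R axis i 1) = z $ i * (norm x)\<^sup>2 - (x \<bullet> z) * x $ i"
            by (simp add: inner_diff_right inner_axis dot_square_norm)
          have 3: "(\<Sum>j\<in>UNIV. x $ j * ((x \<bullet> z) ^ (a + 1) * (z $ i * G' j z)))
              = (x \<bullet> z) ^ (a + 1) * (z $ i * (\<Sum>j\<in>UNIV. x $ j * G' j z))"
            by (simp add: sum_distrib_left mult_ac)
          show ?thesis unfolding 1 2 3 by (simp add: algebra_simps)
        qed
        from trans[OF sym[OF weighted_sum_lincomb[OF this, where w = W and X = X]] rot]
        show ?thesis .
      qed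
      \<comment> \<open>The solution of \<open>identity\<close> for \<open>?L\<close>: the other
        sums all carry \<open>norm x ^ (a - m + 2)\<close>, and \<open>(norm x)\<^sup>2\<close>
        cancels when \<open>x \<noteq> 0\<close>.\<close>
      let ?g = "\<lambda>x. x $ i * g1 x - (1 / (a + 1)) * ((\<Sum>j\<in>UNIV. x $ j * g2 j x) - g3 x)"
      have "?L x = norm x ^ (a - m) * ?g x" if "x \<noteq> 0" for x
      proof -
        let ?r = "norm x ^ (a - m + 2)"
        have "(\<Sum>j\<in>UNIV. x $ j * (?r * g2 j x)) = ?r * (\<Sum>j\<in>UNIV. x $ j * g2 j x)"
          by (simp add: sum_distrib_left mult.left_commute)
        with identity[of x] have "(a + 1) * ((norm x)\<^sup>2 * ?L x - x $ i * (?r * g1 x))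
            + ?r * (\<Sum>j\<in>UNIV. x $ j * g2 j x) - ?r * g3 x = 0"
          by (simp only: g1(2)[OF that] g2(2)[OF that] g3(2)[OF that])
        then have "(norm x)\<^sup>2 * ?L x = ?r * ?g x"
          by (simp add: field_simps)
        also have "\<dots> = (norm x)\<^sup>2 * (norm x ^ (a - m) * ?g x)"
          by (simp add: power_add power2_eq_square)
        finally show ?thesis using that by simp
      qed
      moreover have "?g \<in> forms m"
        unfolding Suc using g1(1) g2(1) g3(1) Suc
        by (intro forms_minus forms_cmult forms_sum forms_coord_mult) auto
      ultimately show ?thesis by (intro bexI[of _ ?g] allI impI)
    qed
    obtain G where G: "\<And>i. G i \<in> forms d" and f: "f = (\<lambda>x. \<Sum>i\<in>UNIV. x $ i * G i x)"
      using forms_SucE[of f d] less.prems(1) unfolding Suc by blast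
    from step[OF G] have "\<forall>i. \<exists>g. g \<in> forms m \<and> (\<forall>x. x \<noteq> 0 \<longrightarrow>
        (\<Sum>z\<in>X. W z * ((x \<bullet> z) ^ a * (z $ i * G i z))) = norm x ^ (a - m) * g x)"
      by blast
    then obtain g where g: "\<And>i. g i \<in> forms m" "\<And>i x. x \<noteq> 0 \<Longrightarrow>
        (\<Sum>z\<in>X. W z * ((x \<bullet> z) ^ a * (z $ i * G i z))) = norm x ^ (a - m) * g i x"
      unfolding choice_iff by blast
    have "(\<Sum>z\<in>X. W z * ((x \<bullet> z) ^ a * f z))
        = (\<Sum>i\<in>UNIV. \<Sum>z\<in>X. W z * ((x \<bullet> z) ^ a * (z $ i * G i z)))" for x
      unfolding f sum_distrib_left by (rule sum.swap)
    then have "\<forall>x. x \<noteq> 0 \<longrightarrow>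
        (\<Sum>z\<in>X. W z * ((x \<bullet> z) ^ a * f z)) = norm x ^ (a - m) * (\<Sum>i\<in>UNIV. g i x)"
      by (simp add: g(2) sum_distrib_left)
    then show ?thesis using forms_sum[of UNIV g m] g(1)
      by (intro bexI[of _ "\<lambda>x. \<Sum>i\<in>UNIV. g i x"]) simp_all
  qed
qed

section \<open>The map \<open>Gamma_hat\<close> on forms\<close>

text \<open>For fixed \<open>x\<close> the integrand with index \<open>j\<close> is a form of degree
  \<open>2 * (j + k)\<close> in \<open>y\<close>, and \<open>j \<le> s\<close> keeps it within the
  degree of the rule.\<close>

lemma Gamma_hat_cubature:
  fixes X :: "(real ^ 'n) set" and f :: "real ^ 'n \<Rightarrow> real"
  assumes cub: "cubature_rule (2 * (s + k)) X W" and h: "degree h \<le> 2 * s" and f: "f \<in> forms (2 * k)"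
  shows "Gamma_hat h k f = (\<lambda>x. \<Sum>j\<le>degree h div 2. coeff h (2 * j) *
    ((\<Sum>z\<in>X. W z * ((x \<bullet> z) ^ (2 * j) * f z)) / norm x powi (2 * (int j - int k))))"
proof -
  have "(LINT y|sphere_measure. (x \<bullet> y) ^ (2 * j) * f y) = (\<Sum>z\<in>X. W z * ((x \<bullet> z) ^ (2 * j) * f z))"
    if "j \<le> degree h div 2" for j x
  proof (rule cubature_rule_integral[OF cub])
    show "(\<lambda>y. (x \<bullet> y) ^ (2 * j) * f y) \<in> forms (2 * (j + k))"
      using forms_mult[OF inner_power_in_forms[of x "2 * j"] f] by simp
    show "j + k \<le> s + k" using that h by linarith
  qed
  then show ?thesis unfolding Gamma_hat_def by simp
qed

text \<open>For \<open>j < k\<close> the cubature sum is a form of degree \<open>2 * j\<close> in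
  \<open>x\<close>, and the negative exponent multiplies it up to degree \<open>2 * k\<close>. For
  \<open>k \<le> j\<close> the denominator cancels by
  \<open>cubature_moment_divisible\<close>.\<close>

lemma Gamma_hat_in_forms:
  fixes X :: "(real ^ 'n) set" and f :: "real ^ 'n \<Rightarrow> real"
  assumes cub: "cubature_rule (2 * (s + k)) X W" and h: "degree h \<le> 2 * s" and f: "f \<in> forms (2 * k)"
    and k: "0 < k"
  shows "Gamma_hat h k f \<in> forms (2 * k)"
  unfolding Gamma_hat_cubature[OF cub h f]
proof (intro forms_sum forms_cmult)
  fix j assume "j \<in> {..degree h div 2}"
  then have j: "j \<le> s" using h by auto
  let ?L = "\<lambda>x. \<Sum>z\<in>X. W z * ((x \<bullet> z) ^ (2 * j) * f z)"
  let ?q = "\<lambda>x. ?L x / norm x powi (2 * (int j - int k))"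
  show "?q \<in> forms (2 * k)"
  proof (cases "j < k")
    case True
    have "(\<lambda>x. W z * ((x \<bullet> z) ^ (2 * j) * f z)) \<in> forms (2 * j)" for z
      using forms_cmult[OF inner_power_in_forms[of z "2 * j"], of "W z * f z"]
      by (simp add: mult_ac inner_commute)
    then have "?L \<in> forms (2 * j)" by (rule forms_sum)
    then have "(\<lambda>x. ?L x * norm x ^ (2 * (k - j))) \<in> forms (2 * j + 2 * (k - j))"
      by (rule forms_mult) (rule norm_power_in_forms, simp)
    moreover have "?q x = ?L x * norm x ^ (2 * (k - j))" for x
    proof -
      have "2 * (int j - int k) = - int (2 * (k - j))" using True by simp
      then show ?thesis
        by (simp only: power_int_minus power_int_of_nat divide_inverse inverse_inverse_eq)
    qed
    ultimately show ?thesis using True by (simp flip: distrib_left)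
  next
    case False
    then obtain g where g: "g \<in> forms (2 * k)"
      "\<And>x. x \<noteq> 0 \<Longrightarrow> ?L x = norm x ^ (2 * j - 2 * k) * g x"
      using cubature_moment_divisible[OF cub f, of "2 * j"] j by auto
    have exp: "2 * (int j - int k) = int (2 * j - 2 * k)" using False by simp
    \<comment> \<open>Divisibility is known only for \<open>x \<noteq> 0\<close>. At the origin the
      numerator vanishes because \<open>j\<close> is positive, and so does \<open>g\<close>, being a
      form of positive degree.\<close>
    have "?q x = g x" for x
    proof (cases "x = 0")
      case True
      have "0 < j" using False k by simp
      then have "?L 0 = 0" by (simp add: power_0_left)
      with True show ?thesis using form_at_0[OF g(1)] k by simp
    next
      case False
      then show ?thesis unfolding g(2)[OF False] exp power_int_of_nat by simp
    qed
    then show ?thesis using g(1) by (simp add: fun_eq_iff)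
  qed
qed

lemma poly_even_sum:
  fixes h :: "real poly"
  assumes "\<forall>i. odd i \<longrightarrow> coeff h i = 0"
  shows "poly h t = (\<Sum>j\<le>degree h div 2. coeff h (2 * j) * t ^ (2 * j))"
proof -
  have "(\<Sum>j\<le>degree h div 2. coeff h (2 * j) * t ^ (2 * j))
      = (\<Sum>i\<in>(\<lambda>j. 2 * j) ` {..degree h div 2}. coeff h i * t ^ i)"
    by (simp add: sum.reindex inj_on_def)
  also have "\<dots> = (\<Sum>i\<le>degree h. coeff h i * t ^ i)"
  proof (rule sum.mono_neutral_left)
    show "\<forall>i\<in>{..degree h} - (\<lambda>j. 2 * j) ` {..degree h div 2}. coeff h i * t ^ i = 0"
    proof
      fix i assume i: "i \<in> {..degree h} - (\<lambda>j. 2 * j) ` {..degree h div 2}"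
      have "odd i"
      proof
        assume "even i"
        then have "i = 2 * (i div 2)" by simp
        moreover have "i div 2 \<in> {..degree h div 2}" using i by (simp add: div_le_mono)
        ultimately show False using i by blast
      qed
      then show "coeff h i * t ^ i = 0" using assms by simp
    qed
  qed auto
  finally show ?thesis by (simp add: poly_altdef)
qed

text \<open>All denominators are \<open>1\<close> on the sphere, and interchanging the sums
  recombines the even powers into \<open>h\<close>. In this shape nonnegativity can be read off term
  by term.\<close>

lemma Gamma_hat_on_sphere:
  fixes X :: "(real ^ 'n) set" and f :: "real ^ 'n \<Rightarrow> real"
  assumes cub: "cubature_rule (2 * (s + k)) X W" and h: "degree h \<le> 2 * s" and f: "f \<in> forms (2 * k)"
    and even_h: "\<forall>i. odd i \<longrightarrow> coeff h i = 0" and x: "x \<in> sphere 0 1"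
  shows "Gamma_hat h k f x = (\<Sum>z\<in>X. W z * (poly h (x \<bullet> z) * f z))"
proof -
  have "Gamma_hat h k f x
      = (\<Sum>j\<le>degree h div 2. \<Sum>z\<in>X. W z * (coeff h (2 * j) * (x \<bullet> z) ^ (2 * j) * f z))"
    using x unfolding Gamma_hat_cubature[OF cub h f] by (simp add: sum_distrib_left mult_ac)
  also have "\<dots> = (\<Sum>z\<in>X. W z * (poly h (x \<bullet> z) * f z))"
    unfolding poly_even_sum[OF even_h] sum_distrib_left sum_distrib_right by (rule sum.swap)
  finally show ?thesis .
qed

theorem theorem1p1:
  fixes h :: "real poly" and s k :: nat
    and X :: "(real ^ 'n) set" and W :: "real ^ 'n \<Rightarrow> real"
    and Q A :: "(real ^ 'n \<Rightarrow> real) set"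
  assumes even_h: "\<forall>i. odd i \<longrightarrow> coeff h i = 0"
    and degree_h: "degree h \<le> 2 * s"
    and nonneg_h: "\<forall>t\<in>{-1..1}. 0 \<le> poly h t"
    and k: "0 < k"
    and cubature: "cubature_rule (2 * (s + k)) X W"
    and Q: "Q = {f \<in> forms (2 * k). \<forall>x\<in>X. 0 \<le> f x}"
    and A: "A = Gamma_hat h k ` Q"
  shows "polyhedral_cone_in (forms (2 * k)) A
    \<and> A \<subseteq> nonneg_forms (2 * k) \<and> nonneg_forms (2 * k) \<subseteq> Q"
proof (intro conjI)
  have X: "finite X" "X \<subseteq> sphere 0 1" "\<And>z. z \<in> X \<Longrightarrow> 0 < W z"
    using cubature by (auto simp: cubature_rule_def)
  show "nonneg_forms (2 * k) \<subseteq> Q"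
    using X(2) unfolding Q nonneg_forms_def by auto
  have in_forms: "Gamma_hat h k f \<in> forms (2 * k)" if "f \<in> forms (2 * k)" for f :: "real ^ 'n \<Rightarrow> real"
    using Gamma_hat_in_forms[OF cubature degree_h that k] .
  show "A \<subseteq> nonneg_forms (2 * k)"
  proof
    fix g assume "g \<in> A"
    then obtain f where f: "f \<in> forms (2 * k)" "\<And>z. z \<in> X \<Longrightarrow> 0 \<le> f z" "g = Gamma_hat h k f"
      unfolding A Q by blast
    have "0 \<le> g x" if x: "x \<in> sphere 0 1" for x
      unfolding f(3) Gamma_hat_on_sphere[OF cubature degree_h f(1) even_h x]
    proof (intro sum_nonneg mult_nonneg_nonneg)
      fix z assume z: "z \<in> X"
      \<comment> \<open>Both points are unit vectors, so their inner product lies in the interval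
        where \<open>h\<close> is nonnegative.\<close>
      then have "\<bar>x \<bullet> z\<bar> \<le> 1"
        using Cauchy_Schwarz_ineq2[of x z] x X(2) by auto
      then show "0 \<le> poly h (x \<bullet> z)" using nonneg_h by (simp add: abs_le_iff)
      show "0 \<le> W z" "0 \<le> f z" using X(3)[OF z] f(2)[OF z] by auto
    qed
    then show "g \<in> nonneg_forms (2 * k)"
      using in_forms[OF f(1)] f(3) by (simp add: nonneg_forms_def)
  qed
  let ?B = "{\<alpha> :: 'n \<Rightarrow> nat. (\<Sum>i\<in>UNIV. \<alpha> i) = 2 * k}"
  let ?b = "\<lambda>\<alpha> (x :: real ^ 'n). \<Prod>i\<in>UNIV. (x $ i) ^ \<alpha> i"
  have b: "?b \<alpha> \<in> forms (2 * k)" if "\<alpha> \<in> ?B" for \<alpha>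
    using that monomial_in_forms by blast
  show "polyhedral_cone_in (forms (2 * k)) A"
    unfolding A Q
  proof (rule polyhedral_cone_in_linear_image[OF finite_exponents _ _ X(1)])
    show "forms (2 * k) = {f. \<exists>c. f = (\<lambda>x. \<Sum>\<alpha>\<in>?B. c \<alpha> * ?b \<alpha> x)}"
      by (rule forms_def)
    show "Gamma_hat h k (?b \<alpha>) \<in> forms (2 * k)" if "\<alpha> \<in> ?B" for \<alpha>
      using in_forms[OF b[OF that]] .
    fix c
    \<comment> \<open>On forms the map is a finite combination of values at the points of
      \<open>X\<close> with coefficients \<open>q j x z\<close> independent of the form, so
      linearity amounts to interchanging finite sums.\<close>
    define q where "q j x z = coeff h (2 * j) * (W z * (x \<bullet> z) ^ (2 * j) / norm x powi (2 * (int j - int k)))"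
      for j x z
    have Gamma: "Gamma_hat h k f x = (\<Sum>j\<le>degree h div 2. \<Sum>z\<in>X. q j x z * f z)"
      if "f \<in> forms (2 * k)" for f :: "real ^ 'n \<Rightarrow> real" and x
      unfolding Gamma_hat_cubature[OF cubature degree_h that] q_def
      by (simp add: sum_distrib_left sum_divide_distrib mult.assoc)
    have "(\<lambda>x. \<Sum>\<alpha>\<in>?B. c \<alpha> * ?b \<alpha> x) \<in> forms (2 * k)"
      by (intro forms_sum forms_cmult b)
    note comb = Gamma[OF this]
    show "Gamma_hat h k (\<lambda>x. \<Sum>\<alpha>\<in>?B. c \<alpha> * ?b \<alpha> x)
        = (\<lambda>x. \<Sum>\<alpha>\<in>?B. c \<alpha> * Gamma_hat h k (?b \<alpha>) x)"
    proof
      fix x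
      have "Gamma_hat h k (\<lambda>x. \<Sum>\<alpha>\<in>?B. c \<alpha> * ?b \<alpha> x) x
          = (\<Sum>j\<le>degree h div 2. \<Sum>z\<in>X. \<Sum>\<alpha>\<in>?B. c \<alpha> * (q j x z * ?b \<alpha> z))"
        unfolding comb by (simp add: sum_distrib_left mult.left_commute)
      also have "\<dots> = (\<Sum>j\<le>degree h div 2. \<Sum>\<alpha>\<in>?B. \<Sum>z\<in>X. c \<alpha> * (q j x z * ?b \<alpha> z))"
        by (intro sum.cong refl sum.swap)
      also have "\<dots> = (\<Sum>\<alpha>\<in>?B. \<Sum>j\<le>degree h div 2. \<Sum>z\<in>X. c \<alpha> * (q j x z * ?b \<alpha> z))"
        by (rule sum.swap)
      also have "\<dots> = (\<Sum>\<alpha>\<in>?B. c \<alpha> * Gamma_hat h k (?b \<alpha>) x)"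
        by (intro sum.cong refl) (simp add: Gamma[OF b] sum_distrib_left)
      finally show "Gamma_hat h k (\<lambda>x. \<Sum>\<alpha>\<in>?B. c \<alpha> * ?b \<alpha> x) x
          = (\<Sum>\<alpha>\<in>?B. c \<alpha> * Gamma_hat h k (?b \<alpha>) x)" .
    qed
  qed
qed

end
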